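(* Let $\lambda>0$, let $(\mathsf b_{\mathsf m})_{\mathsf m\in\mathbb N^d}\subset\mathbb R^d$ be an arbitrary sequence of points, and for $\mathsf m\in\mathbb N^d$ let $$\varphi_{\mathsf m,0}(\mathsf x)=\mathcal N_{\mathsf m,\lambda}\,\delta(\mathsf x),\qquad\psi_{\mathsf m,T}(\mathsf x)=\mathcal N_{\mathsf m,\lambda}\,\delta(\mathsf x-\mathsf b_{\mathsf m}),\qquad\mathcal N_{\mathsf m,\lambda}=\left(\frac{2\pi\sinh(\lambda T)}\lambda\right)^{\frac d4}\exp\left[\frac{\lambda\coth(\lambda T)|\mathsf b_{\mathsf m}|^2}4\right].$$ Let $\mu_{\mathsf m}$ be the probability measure on $\mathcal B_d\times\mathcal B_d$ with joint density $\varphi_{\mathsf m,0}(\mathsf x)g_\lambda(\mathsf x,T,\mathsf y)\psi_{\mathsf m,T}(\mathsf y)$. Then the Bernstein process $Z^{\mathsf m,\lambda}_{\tau\in[0,T]}$ associated with $\mu_{\mathsf m}$ (in the sense of the context) is a non-stationary Gaussian and Markovian process such that the following properties are valid. (a) We have $$\mathbb P_{\mu_{\mathsf m}}\left(Z^{\mathsf m,\lambda}_t\in F\right)=(2\pi\sigma_\lambda(t))^{-\frac d2}\int_F d\mathsf x\exp\left[-\frac{|\mathsf x-\mathsf b_{\mathsf m,\lambda}(t)|^2}{2\sigma_\lambda(t)}\right]$$ for each $t\in(0,T)$ and every $F\in\mathcal B_d$, where $$\mathsf b_{\mathsf m,\lambda}(t)=\frac{\sinh(\lambda t)}{\sinh(\lambda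 T)}\mathsf b_{\mathsf m},\qquad\sigma_\lambda(t)=\frac{\sinh(\lambda(T-t))\sinh(\lambda t)}{\lambda\sinh(\lambda T)} .$$ Furthermore $$\mathbb P_{\mu_{\mathsf m}}\left(Z^{\mathsf m,\lambda}_0=\mathsf o\right)=\mathbb P_{\mu_{\mathsf m}}\left(Z^{\mathsf m,\lambda}_T=\mathsf b_{\mathsf m}\right)=1$$ for every $\mathsf m\in\mathbb N^d$, where $\mathsf o$ is the origin of $\mathbb R^d$. (b) We have $$\mathbb E_{\mu_{\mathsf m}}\left((Z^{\mathsf m,\lambda,i}_s-b^i_{\mathsf m,\lambda}(s))(Z^{\mathsf m,\lambda,j}_t-b^j_{\mathsf m,\lambda}(t))\right)=\begin{cases}\dfrac{\sinh(\lambda(T-t))\sinh(\lambda s)}{\lambda\sinh(\lambda T)}\delta_{i,j}&\text{for }t\ge s,\\[2mm]\dfrac{\sinh(\lambda(T-s))\sinh(\lambda t)}{\lambda\sinh(\lambda T)}\delta_{i,j}&\text{for }t\le s\end{cases}$$ for all $s,t\in[0,T]$ and all $i,j\in\{1,\dots,d\}$, where $b^i_{\mathsf m,\lambda}$ denotes the $i$th component of $\mathsf b_{\mathsf m,\lambda}$. (c) We have $$\mathbb E_{\mu_{\mathsf m}}\left(b(Z^{\mathsf m,\lambda}_t)\right)=(2\pi\sigma_\lambda(t))^{-\frac d2}\int_{\mathbb R^d}d\mathsf x\,b(\mathsf x)\exp\left[-\frac{|\mathsf x-\mathsf b_{\mathsf m,\lambda}(t)|^2}{2\sigma_\lambda(t)}\right]$$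 for each bounded Borel measurable function $b:\mathbb R^d\to\mathbb C$ and every $t\in(0,T)$.
   Context: Fix $d\in\mathbb N^+$ and $T\in(0,+\infty)$; $\mathcal B_d$ is the Borel $\sigma$-algebra of $\mathbb R^d$; $\mathbb N=\{0,1,2,\dots\}$; $\delta$ is the Dirac measure, $\delta_{i,j}$ the Kronecker symbol. Mehler's kernel (the integral kernel of $\exp[-tH_\lambda]$ with $H_\lambda=-\frac12\Delta_{\mathsf x}+\frac{\lambda^2}2|\mathsf x|^2$) is $$g_\lambda(\mathsf x,t,\mathsf y)=\left(\frac{2\pi\sinh(\lambda t)}\lambda\right)^{-\frac d2}\exp\left[-\frac{\lambda\left(\cosh(\lambda t)(|\mathsf x|^2+|\mathsf y|^2)-2(\mathsf x,\mathsf y)_{\mathbb R^d}\right)}{2\sinh(\lambda t)}\right],\quad t\in(0,T].$$ Bernstein process: an $\mathbb R^d$-valued process $Z_{\tau\in[0,T]}$ on a complete probability space $(\Omega,\mathcal F,\mathbb P)$ such that $\mathbb E(b(Z_r)\mid\mathcal F_s^+\vee\mathcal F_t^-)=\mathbb E(b(Z_r)\mid Z_s,Z_t)$ $\mathbb P$-a.e. for every bounded Borel $b:\mathbb R^d\to\mathbb C$ and all $r\in(s,t)\subset[0,T]$, where $\mathcal F_s^+=\sigma\{Z_\tau^{-1}(F):\tau\le s,F\in\mathcal B_d\}$ and $\mathcal F_t^-=\sigma\{Z_\tau^{-1}(F):\tau\ge t,F\in\mathcal B_d\}$. Given a probability measure $\mu$ on $\mathcal B_d\times\mathcal B_d$,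 the Bernstein process associated with $\mu$ is the Bernstein process on a probability space $(\Omega,\mathcal F,\mathbb P_\mu)$ whose law is determined by $$\mathbb P_\mu(Z_0\in F_0,Z_{t_1}\in F_1,\dots,Z_{t_n}\in F_n,Z_T\in F_T)=\int_{F_0\times F_T}\frac{d\mu(\mathsf x,\mathsf y)}{g_\lambda(\mathsf x,T,\mathsf y)}\int_{F_1}d\mathsf x_1\cdots\int_{F_n}d\mathsf x_n\prod_{k=1}^n g_\lambda(\mathsf x_k,t_k-t_{k-1},\mathsf x_{k-1})\,g_\lambda(\mathsf y,T-t_n,\mathsf x_n)$$ for all Borel $F_0,\dots,F_n,F_T$ and $t_0=0<t_1<\dots<t_n<T$, with $\mathsf x_0=\mathsf x$. $\mathbb E_\mu$ is expectation under $\mathbb P_\mu$. A process is stationary if its finite-dimensional distributions are invariant under time translations (within the time interval). *)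

theory Defs
  imports "HOL-Probability.Probability"
begin

definition mehler_kernel :: "real \<Rightarrow> real ^ 'n \<Rightarrow> real \<Rightarrow> real ^ 'n \<Rightarrow> real" where
  "mehler_kernel lam x t y =
     (2 * pi * sinh (lam * t) / lam) powr (- real CARD('n) / 2) *
     exp (- (lam * (cosh (lam * t) * ((norm x)\<^sup>2 + (norm y)\<^sup>2) - 2 * (x \<bullet> y)) / (2 * sinh (lam * t))))"


subsection \<open>Conditioning on parts of a process\<close>

definition generated_sigma ::
    "'w measure \<Rightarrow> (real \<Rightarrow> 'w \<Rightarrow> 'a::topological_space) \<Rightarrow> real set \<Rightarrow> 'w measure" where
  "generated_sigma M Z I =
     sigma (space M) {Z \<tau> -` F \<inter> space M | \<tau> F. \<tau> \<in> I \<and> F \<in> sets borel}"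

definition sigma_join :: "'w measure \<Rightarrow> 'w measure \<Rightarrow> 'w measure" where
  "sigma_join A B = sigma (space A) (sets A \<union> sets B)"

text \<open>The library only provides conditional expectations of real functions.\<close>

definition complex_cond_exp :: "'w measure \<Rightarrow> 'w measure \<Rightarrow> ('w \<Rightarrow> complex) \<Rightarrow> 'w \<Rightarrow> complex" where
  "complex_cond_exp M A f =
     (\<lambda>\<omega>. Complex (real_cond_exp M A (\<lambda>\<omega>. Re (f \<omega>)) \<omega>) (real_cond_exp M A (\<lambda>\<omega>. Im (f \<omega>)) \<omega>))"


subsection \<open>Processes indexed by \<open>[0,T]\<close>\<close>

text \<open>
  A process is a function of all real times, but only its values at times in \<open>[0,T]\<close>
  are ever constrained or used.
\<close>

definition bernstein_process ::
    "real \<Rightarrow> 'w measure \<Rightarrow> (real \<Rightarrow> 'w \<Rightarrow> real ^ 'n) \<Rightarrow> bool" where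
  "bernstein_process T M Z \<longleftrightarrow>
     prob_space M \<and> complete_measure M \<and>
     (\<forall>\<tau>\<in>{0..T}. Z \<tau> \<in> borel_measurable M) \<and>
     (\<forall>s r t. 0 \<le> s \<and> s < r \<and> r < t \<and> t \<le> T \<longrightarrow>
       (\<forall>f :: real ^ 'n \<Rightarrow> complex. f \<in> borel_measurable borel \<and> bounded (range f) \<longrightarrow>
         (AE \<omega> in M.
            complex_cond_exp M
              (sigma_join (generated_sigma M Z {0..s}) (generated_sigma M Z {t..T}))
              (\<lambda>\<omega>. f (Z r \<omega>)) \<omega> =
            complex_cond_exp M (generated_sigma M Z {s, t}) (\<lambda>\<omega>. f (Z r \<omega>)) \<omega>)))"

definition markov_process ::
    "real \<Rightarrow> 'w measure \<Rightarrow> (real \<Rightarrow> 'w \<Rightarrow> real ^ 'n) \<Rightarrow> bool" where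
  "markov_process T M Z \<longleftrightarrow>
     (\<forall>s t. 0 \<le> s \<and> s \<le> t \<and> t \<le> T \<longrightarrow>
       (\<forall>f :: real ^ 'n \<Rightarrow> complex. f \<in> borel_measurable borel \<and> bounded (range f) \<longrightarrow>
         (AE \<omega> in M.
            complex_cond_exp M (generated_sigma M Z {0..s}) (\<lambda>\<omega>. f (Z t \<omega>)) \<omega> =
            complex_cond_exp M (generated_sigma M Z {s}) (\<lambda>\<omega>. f (Z t \<omega>)) \<omega>)))"

text \<open>Point masses count as Gaussian (with variance \<open>0\<close>).\<close>

definition gaussian_variable :: "'w measure \<Rightarrow> ('w \<Rightarrow> real) \<Rightarrow> bool" where
  "gaussian_variable M X \<longleftrightarrow> X \<in> borel_measurable M \<and>
     ((\<exists>c. AE \<omega> in M. X \<omega> = c) \<or>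
      (\<exists>c \<sigma>. \<sigma> > 0 \<and> distributed M lborel X (normal_density c \<sigma>)))"

definition gaussian_process ::
    "real \<Rightarrow> 'w measure \<Rightarrow> (real \<Rightarrow> 'w \<Rightarrow> real ^ 'n) \<Rightarrow> bool" where
  "gaussian_process T M Z \<longleftrightarrow>
     (\<forall>J (a :: real \<Rightarrow> real ^ 'n). finite J \<and> J \<subseteq> {0..T} \<longrightarrow>
        gaussian_variable M (\<lambda>\<omega>. \<Sum>t\<in>J. a t \<bullet> Z t \<omega>))"

definition stationary_process ::
    "real \<Rightarrow> 'w measure \<Rightarrow> (real \<Rightarrow> 'w \<Rightarrow> real ^ 'n) \<Rightarrow> bool" where
  "stationary_process T M Z \<longleftrightarrow>
     (\<forall>J h. finite J \<and> J \<subseteq> {0..T} \<and> (\<lambda>t. t + h) ` J \<subseteq> {0..T} \<longrightarrow>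
        distr M (\<Pi>\<^sub>M t\<in>J. borel) (\<lambda>\<omega>. \<lambda>t\<in>J. Z (t + h) \<omega>) =
        distr M (\<Pi>\<^sub>M t\<in>J. borel) (\<lambda>\<omega>. \<lambda>t\<in>J. Z t \<omega>))"


subsection \<open>The Bernstein process associated with a joint endpoint distribution\<close>

text \<open>
  \<open>iterated_integral F n h x\<close> is \<open>\<integral>\<^bsub>F 1\<^esub> dx\<^sub>1 \<dots> \<integral>\<^bsub>F n\<^esub> dx\<^sub>n h (x\<^sub>0, x\<^sub>1, \<dots>, x\<^sub>n)\<close> where \<open>x\<^sub>0 = x 0\<close>;
  the coordinates \<open>1, \<dots>, n\<close> of \<open>x\<close> are overwritten.
\<close>

primrec iterated_integral ::
    "(nat \<Rightarrow> 'a::euclidean_space set) \<Rightarrow> nat \<Rightarrow> ((nat \<Rightarrow> 'a) \<Rightarrow> ennreal) \<Rightarrow> (nat \<Rightarrow> 'a) \<Rightarrow> ennreal" where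
  "iterated_integral F 0 h x = h x"
| "iterated_integral F (Suc n) h x =
     iterated_integral F n (\<lambda>x. \<integral>\<^sup>+z\<in>F (Suc n). h (x(Suc n := z)) \<partial>lborel) x"

definition associated_bernstein_process ::
    "real \<Rightarrow> real \<Rightarrow> ((real ^ 'n) \<times> (real ^ 'n)) measure \<Rightarrow> 'w measure \<Rightarrow> (real \<Rightarrow> 'w \<Rightarrow> real ^ 'n) \<Rightarrow> bool" where
  "associated_bernstein_process lam T \<mu> M Z \<longleftrightarrow>
     bernstein_process T M Z \<and>
     (\<forall>n\<ge>1. \<forall>(t :: nat \<Rightarrow> real) F FT.
        t 0 = 0 \<and> (\<forall>k<n. t k < t (Suc k)) \<and> t n < T \<and>
        (\<forall>k\<le>n. F k \<in> sets borel) \<and> FT \<in> sets borel \<longrightarrow>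
        emeasure M {\<omega> \<in> space M. (\<forall>k\<le>n. Z (t k) \<omega> \<in> F k) \<and> Z T \<omega> \<in> FT} =
        (\<integral>\<^sup>+p\<in>F 0 \<times> FT.
           (case p of (x, y) \<Rightarrow>
              iterated_integral F n
                (\<lambda>x. ennreal ((\<Prod>k=1..n. mehler_kernel lam (x k) (t k - t (k - 1)) (x (k - 1))) *
                              mehler_kernel lam y (T - t n) (x n)))
                (\<lambda>_. x)
              / ennreal (mehler_kernel lam x T y)) \<partial>\<mu>))"


subsection \<open>Dirac endpoint data\<close>

definition norm_factor :: "real \<Rightarrow> real \<Rightarrow> real ^ 'n \<Rightarrow> real" where
  "norm_factor lam T c =
     (2 * pi * sinh (lam * T) / lam) powr (real CARD('n) / 4) *
     exp (lam * (cosh (lam * T) / sinh (lam * T)) * (norm c)\<^sup>2 / 4)"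

text \<open>
  The multiples \<open>\<phi>\<close>, \<open>\<psi>\<close> of Dirac measures are treated as measures, and the measure with
  density \<open>\<phi>(x) g(x,T,y) \<psi>(y)\<close> has density \<open>g(x,T,y)\<close> with respect to \<open>\<phi> \<otimes> \<psi>\<close>.
\<close>

definition phi_0 :: "real \<Rightarrow> real \<Rightarrow> (nat ^ 'n \<Rightarrow> real ^ 'n) \<Rightarrow> nat ^ 'n \<Rightarrow> (real ^ 'n) measure" where
  "phi_0 lam T b m = scale_measure (ennreal (norm_factor lam T (b m))) (return borel 0)"

definition psi_T :: "real \<Rightarrow> real \<Rightarrow> (nat ^ 'n \<Rightarrow> real ^ 'n) \<Rightarrow> nat ^ 'n \<Rightarrow> (real ^ 'n) measure" where
  "psi_T lam T b m = scale_measure (ennreal (norm_factor lam T (b m))) (return borel (b m))"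

definition endpoint_measure ::
    "real \<Rightarrow> real \<Rightarrow> (nat ^ 'n \<Rightarrow> real ^ 'n) \<Rightarrow> nat ^ 'n \<Rightarrow> ((real ^ 'n) \<times> (real ^ 'n)) measure" where
  "endpoint_measure lam T b m =
     density (phi_0 lam T b m \<Otimes>\<^sub>M psi_T lam T b m) (\<lambda>(x, y). ennreal (mehler_kernel lam x T y))"

definition bridge_mean :: "real \<Rightarrow> real \<Rightarrow> (nat ^ 'n \<Rightarrow> real ^ 'n) \<Rightarrow> nat ^ 'n \<Rightarrow> real \<Rightarrow> real ^ 'n" where
  "bridge_mean lam T b m t = (sinh (lam * t) / sinh (lam * T)) *\<^sub>R b m"

definition bridge_var :: "real \<Rightarrow> real \<Rightarrow> real \<Rightarrow> real" where
  "bridge_var lam T t = sinh (lam * (T - t)) * sinh (lam * t) / (lam * sinh (lam * T))"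

end

theory Submission
  imports Defs
begin

text \<open>
  The measure concentrated at the pair \<open>(0, b m)\<close> pins the process at both ends, so the process is an
  Ornstein-Uhlenbeck type bridge. The product of Mehler kernels on either side of an intermediate point is
  the kernel over the whole interval times a Gaussian density in that point (\<open>mehler_kernel_pinned\<close>). Dividing by the
  kernel between the endpoints, as the defining formula does, therefore leaves Gaussian densities: the
  marginal at an interior time, and a transition density whose mean is affine in the present position and
  whose variance does not depend on it.

  Only the distributions of one and of two interior times are needed. Since \<open>Z T\<close> is almost surely constant, the
  Bernstein property with final time \<open>T\<close> is the Markov property (\<open>bernstein_imp_markov_if_terminal_const\<close>), and this
  propagates the two-time law to all of the past (\<open>past_rectangle\<close>). Consequently the characteristic function
  of a linear combination of finitely many centred positions can be computed by removing the latest time,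
  again and again (\<open>transition_char\<close>, \<open>char_with_origin\<close>); it is the exponential of a quadratic form built from the
  covariance in the theorem. Levy's uniqueness theorem turns this into Gaussianity, and second moments
  with polarisation give the covariance. The process is not stationary, because its law is a point mass
  at time zero and has a density at interior times.
\<close>

section \<open>Isotropic Gaussian densities\<close>

definition isotropic_normal :: "'a::euclidean_space \<Rightarrow> real \<Rightarrow> 'a \<Rightarrow> real" where
  "isotropic_normal c v x =
     (2 * pi * v) powr (- real DIM('a) / 2) * exp (- (norm (x - c))\<^sup>2 / (2 * v))"

lemma isotropic_normal_nonneg [simp]: "0 \<le> isotropic_normal c v x"
  by (simp add: isotropic_normal_def)

lemma borel_measurable_isotropic_normal [measurable (raw)]:
  assumes [measurable]: "f \<in> borel_measurable N" "g \<in> borel_measurable N"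
  shows "(\<lambda>x. isotropic_normal (f x) v (g x)) \<in> borel_measurable N"
  unfolding isotropic_normal_def by measurable

text \<open>
  The density factorises over an orthonormal basis; its total mass and its characteristic
  function therefore reduce to the one-dimensional ones.
\<close>

lemma isotropic_normal_eq_prod:
  fixes c x :: "'a::euclidean_space"
  assumes "v > 0"
  shows "isotropic_normal c v x = (\<Prod>e\<in>Basis. normal_density (c \<bullet> e) (sqrt v) (x \<bullet> e))"
proof -
  have "(norm (x - c))\<^sup>2 = (\<Sum>e\<in>Basis. (x \<bullet> e - c \<bullet> e)\<^sup>2)"
    unfolding power2_norm_eq_inner by (subst euclidean_inner) (simp add: inner_diff_left power2_eq_square)
  moreover have "(1 / sqrt (2 * pi * v)) ^ DIM('a) = (2 * pi * v) powr (- real DIM('a) / 2)"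
    using assms by (simp add: powr_half_sqrt[symmetric] powr_realpow[symmetric] powr_powr powr_minus_divide[symmetric])
  moreover have "(\<Prod>e\<in>Basis. normal_density (c \<bullet> e) (sqrt v) (x \<bullet> e))
    = (1 / sqrt (2 * pi * v)) ^ DIM('a) * exp (\<Sum>e\<in>Basis. - (x \<bullet> e - c \<bullet> e)\<^sup>2 / (2 * v))"
    unfolding normal_density_def prod.distrib exp_sum[OF finite_Basis] using assms by simp
  ultimately show ?thesis
    by (simp add: isotropic_normal_def sum_negf sum_divide_distrib)
qed

text \<open>
  The substitution \<open>x \<mapsto> m + \<sigma> x\<close> reduces this to the standard normal law.
\<close>

lemma char_normal:
  fixes m \<sigma> t :: real
  assumes "\<sigma> > 0"
  shows "(CLINT x|lborel. normal_density m \<sigma> x *\<^sub>R iexp (t * x))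
    = iexp (t * m) * complex_of_real (exp (- (t * \<sigma>)\<^sup>2 / 2))"
proof -
  have *: "normal_density m \<sigma> (m + \<sigma> * x) = std_normal_density x / \<sigma>" for x
    using assms by (simp add: normal_density_def power_mult_distrib real_sqrt_mult field_simps)
  have "(CLINT x|lborel. normal_density m \<sigma> x *\<^sub>R iexp (t * x))
      = \<bar>\<sigma>\<bar> *\<^sub>R (CLINT x|lborel. normal_density m \<sigma> (m + \<sigma> * x) *\<^sub>R iexp (t * (m + \<sigma> * x)))"
    using assms by (intro lborel_integral_real_affine) simp
  also have "\<dots> = (CLINT x|lborel. iexp (t * m) * (std_normal_density x *\<^sub>R iexp ((t * \<sigma>) * x)))"
    using assms unfolding *
    by (subst integral_scaleR_right[symmetric], intro Bochner_Integration.integral_cong)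
       (auto simp: exp_add[symmetric] scaleR_conv_of_real field_simps)
  also have "\<dots> = iexp (t * m) * (CLINT x|lborel. std_normal_density x *\<^sub>R iexp ((t * \<sigma>) * x))"
    by (rule integral_mult_right_zero)
  also have "\<dots> = iexp (t * m) * char std_normal_distribution (t * \<sigma>)"
    by (simp add: char_def integral_density normal_density_nonneg)
  finally show ?thesis by (simp add: char_std_normal_distribution)
qed

lemma isotropic_normal_density_facts:
  fixes c \<theta> :: "'a::euclidean_space"
  assumes "v > 0"
  shows nn_integral_isotropic_normal: "(\<integral>\<^sup>+ x. ennreal (isotropic_normal c v x) \<partial>lborel) = 1"
    and char_isotropic_normal: "(CLINT x|lborel. isotropic_normal c v x *\<^sub>R iexp (\<theta> \<bullet> x))
      = iexp (\<theta> \<bullet> c) * complex_of_real (exp (- v * (\<theta> \<bullet> \<theta>) / 2))"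
proof -
  interpret product_sigma_finite "\<lambda>_::'a. lborel :: real measure" ..
  have v: "sqrt v > 0" using assms by simp
  show "(\<integral>\<^sup>+ x. ennreal (isotropic_normal c v x) \<partial>lborel) = 1"
    using v nn_integral_lborel_prod[of "\<lambda>e x. ennreal (normal_density (c \<bullet> e) (sqrt v) x)"]
      prob_space.emeasure_space_1[OF prob_space_normal_density[OF v]]
    by (simp add: isotropic_normal_eq_prod[OF assms] prod_ennreal normal_density_nonneg emeasure_density)
  have "(CLINT x|lborel. isotropic_normal c v x *\<^sub>R iexp (\<theta> \<bullet> x))
    = (CLINT x|(\<Pi>\<^sub>M e\<in>(Basis::'a set). lborel).
        (\<Prod>e\<in>Basis. normal_density (c \<bullet> e) (sqrt v) (x e) *\<^sub>R iexp ((\<theta> \<bullet> e) * x e)))"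
    unfolding lborel_eq[where 'a='a] isotropic_normal_eq_prod[OF assms]
    by (subst integral_distr)
       (auto intro!: Bochner_Integration.integral_cong simp: scaleR_conv_of_real prod.distrib exp_sum[symmetric]
          sum_distrib_left inner_sum_right mult_ac)
  also have "\<dots> = (\<Prod>e\<in>Basis. (CLINT x|lborel. normal_density (c \<bullet> e) (sqrt v) x *\<^sub>R iexp ((\<theta> \<bullet> e) * x)))"
    using v by (intro product_integral_prod integrable_scaleR_left)
      (auto intro!: Bochner_Integration.integrable_bound[OF integrable_normal_density[OF v]])
  also have "\<dots> = (\<Prod>e\<in>Basis. iexp ((\<theta> \<bullet> e) * (c \<bullet> e)) * complex_of_real (exp (- v * ((\<theta> \<bullet> e) * (\<theta> \<bullet> e)) / 2)))"
    unfolding char_normal[OF v] using assms by (simp add: power_mult_distrib, simp add: power2_eq_square mult_ac)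
  also have "\<dots> = iexp (\<theta> \<bullet> c) * complex_of_real (exp (- v * (\<theta> \<bullet> \<theta>) / 2))"
    unfolding euclidean_inner[of \<theta> c] euclidean_inner[of \<theta> \<theta>]
    by (simp add: prod.distrib exp_sum[symmetric] sum_distrib_left sum_divide_distrib sum_negf
        of_real_prod[symmetric] del: of_real_prod)
  finally show "(CLINT x|lborel. isotropic_normal c v x *\<^sub>R iexp (\<theta> \<bullet> x))
      = iexp (\<theta> \<bullet> c) * complex_of_real (exp (- v * (\<theta> \<bullet> \<theta>) / 2))" .
qed

section \<open>The Mehler kernel and its bridge\<close>

text \<open>
  Mean and variance of a Mehler bridge that sits at \<open>x\<close> a time \<open>p\<close> ago and at \<open>y\<close> a time \<open>q\<close> ahead.
\<close>

definition pinned_mean :: "real \<Rightarrow> real \<Rightarrow> real \<Rightarrow> 'a::euclidean_space \<Rightarrow> 'a \<Rightarrow> 'a" where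
  "pinned_mean lam p q x y =
     (sinh (lam * q) / sinh (lam * (p + q))) *\<^sub>R x + (sinh (lam * p) / sinh (lam * (p + q))) *\<^sub>R y"

definition pinned_var :: "real \<Rightarrow> real \<Rightarrow> real \<Rightarrow> real" where
  "pinned_var lam p q = sinh (lam * p) * sinh (lam * q) / (lam * sinh (lam * (p + q)))"

lemma pinned_var_pos: "lam > 0 \<Longrightarrow> p > 0 \<Longrightarrow> q > 0 \<Longrightarrow> pinned_var lam p q > 0"
  by (simp add: pinned_var_def)

lemma mehler_kernel_pos [simp]:
  "lam > 0 \<Longrightarrow> t > 0 \<Longrightarrow> mehler_kernel lam x t y > 0"
  by (simp add: mehler_kernel_def)

lemma mehler_kernel_commute: "mehler_kernel lam x t y = mehler_kernel lam y t x"
  by (simp add: mehler_kernel_def inner_commute add.commute)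

lemma borel_measurable_mehler_kernel [measurable (raw)]:
  assumes [measurable]: "f \<in> borel_measurable N" "g \<in> borel_measurable N"
  shows "(\<lambda>x. mehler_kernel lam (f x) t (g x)) \<in> borel_measurable N"
  unfolding mehler_kernel_def by measurable

text \<open>
  A strengthened Chapman-Kolmogorov identity: as a function of the intermediate point \<open>z\<close>, the product
  of two kernels is the composite kernel times a normalised Gaussian. Completing the square in \<open>z\<close>
  shows this; the coefficients match because of the addition formulas for \<open>sinh\<close> and \<open>cosh\<close> and
  \<open>cosh\<^sup>2 = 1 + sinh\<^sup>2\<close>. All time-dependent densities of the process come from this identity.
\<close>

lemma mehler_kernel_pinned:
  fixes x y z :: "real ^ 'n"
  assumes "lam > 0" "p > 0" "q > 0"
  shows "mehler_kernel lam z p x * mehler_kernel lam y q z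
    = mehler_kernel lam y (p + q) x * isotropic_normal (pinned_mean lam p q x y) (pinned_var lam p q) z"
proof -
  define A B where "A = sinh (lam * p)" and "B = sinh (lam * q)"
  define a b where "a = cosh (lam * p)" and "b = cosh (lam * q)"
  define S where "S = sinh (lam * (p + q))"
  have pos: "A > 0" "B > 0" "S > 0" using assms by (simp_all add: A_def B_def S_def)
  have S: "S = A * b + B * a" and C: "cosh (lam * (p + q)) = a * b + A * B"
    by (simp_all add: S_def A_def B_def a_def b_def distrib_left sinh_add cosh_add)
  have a2: "a\<^sup>2 = 1 + A\<^sup>2" and b2: "b\<^sup>2 = 1 + B\<^sup>2"
    by (simp_all add: a_def b_def A_def B_def cosh_square_eq)
  have pre: "(2 * pi * A / lam) powr (- real CARD('n) / 2) * (2 * pi * B / lam) powr (- real CARD('n) / 2)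
    = (2 * pi * S / lam) powr (- real CARD('n) / 2) * (2 * pi * (A * B / (lam * S))) powr (- real CARD('n) / 2)"
    using assms pos by (simp add: powr_mult[symmetric] field_simps)
  \<comment> \<open>The exponents: both sides are quadratic in the three points, here with the
    squared norms and inner products as independent unknowns.\<close>
  have key: "- (lam * (a * (Z + X) - 2 * zx) / (2 * A)) - lam * (b * (Y + Z) - 2 * yz) / (2 * B)
    = - (lam * ((a * b + A * B) * (Y + X) - 2 * yx) / (2 * S))
      - (Z - 2 * (B / S * zx + A / S * yz) + (B / S) * (B / S) * X + 2 * (B / S) * (A / S) * yx + (A / S) * (A / S) * Y)
         / (2 * (A * B / (lam * S)))" for X Y Z zx yz yx :: real
  proof -
    have cX: "a * S = B + A * (a * b + A * B)" and cY: "b * S = A + B * (a * b + A * B)"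
      using a2 b2 unfolding S by algebra+
    have "a / A = (a * b + A * B) / S + B / (A * S)" "b / B = (a * b + A * B) / S + A / (B * S)"
      using pos cX cY by (simp_all add: field_simps)
    moreover have "a / A + b / B = S / (A * B)" using pos unfolding S by (simp add: field_simps)
    moreover have "- (lam * (a * (Z + X) - 2 * zx) / (2 * A)) - lam * (b * (Y + Z) - 2 * yz) / (2 * B)
      = - lam / 2 * ((a / A + b / B) * Z + (a / A) * X + (b / B) * Y - 2 * zx / A - 2 * yz / B)"
      using pos by (simp add: field_simps)
    moreover have "- (lam * (c * (Y + X) - 2 * yx) / (2 * S))
      - (Z - 2 * (B / S * zx + A / S * yz) + (B / S) * (B / S) * X + 2 * (B / S) * (A / S) * yx + (A / S) * (A / S) * Y)
         / (2 * (A * B / (lam * S)))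
      = - lam / 2 * (S / (A * B) * Z + (c / S + B / (A * S)) * X + (c / S + A / (B * S)) * Y
          - 2 * zx / A - 2 * yz / B)" for c
      using pos assms by (simp add: field_simps)
    ultimately show ?thesis by simp
  qed
  have nrm: "(norm (z - pinned_mean lam p q x y))\<^sup>2 = (norm z)\<^sup>2 - 2 * (B / S * (z \<bullet> x) + A / S * (y \<bullet> z))
      + (B / S) * (B / S) * (norm x)\<^sup>2 + 2 * (B / S) * (A / S) * (y \<bullet> x) + (A / S) * (A / S) * (norm y)\<^sup>2"
    unfolding power2_norm_eq_inner pinned_mean_def A_def[symmetric] B_def[symmetric] S_def[symmetric]
    by (simp add: inner_diff_left inner_diff_right inner_add_left inner_add_right inner_commute algebra_simps)
  have combine: "P1 * exp e1 * (P2 * exp e2) = P3 * exp e3 * (P4 * exp e4)"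
    if "P1 * P2 = P3 * P4" "e1 + e2 = e3 + e4" for P1 P2 P3 P4 e1 e2 e3 e4 :: real
  proof -
    have "P1 * exp e1 * (P2 * exp e2) = (P1 * P2) * exp (e1 + e2)" by (simp add: exp_add)
    then show ?thesis unfolding that by (simp add: exp_add)
  qed
  show ?thesis
    unfolding mehler_kernel_def isotropic_normal_def nrm pinned_var_def A_def[symmetric] B_def[symmetric]
      S_def[symmetric] a_def[symmetric] b_def[symmetric] C DIM_cart DIM_real mult_1_right
    by (rule combine[OF pre])
      (use key[of "(norm z)\<^sup>2" "(norm x)\<^sup>2" "z \<bullet> x" "(norm y)\<^sup>2" "y \<bullet> z" "y \<bullet> x"] in
        \<open>simp only: minus_divide_left[symmetric] add_uminus_conv_diff\<close>)
qed

lemma mehler_kernel_norm_factor: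
  fixes y :: "real ^ 'n"
  assumes "lam > 0" "T > 0"
  shows "norm_factor lam T y * norm_factor lam T y * mehler_kernel lam 0 T y = 1"
proof -
  let ?A = "2 * pi * sinh (lam * T) / lam" and ?d = "real CARD('n)"
  let ?e = "lam * (cosh (lam * T) / sinh (lam * T)) * (norm y)\<^sup>2"
  have "?A > 0" using assms by simp
  then have "?A powr (?d / 4) * ?A powr (?d / 4) * ?A powr (- ?d / 2) = 1"
    using assms unfolding powr_add[symmetric] by simp
  moreover have "exp (?e / 4) * exp (?e / 4) * exp (- (?e / 2)) = 1"
    by (simp add: exp_add[symmetric])
  moreover have "mehler_kernel lam 0 T y = ?A powr (- ?d / 2) * exp (- (?e / 2))"
    using assms by (simp add: mehler_kernel_def field_simps)
  ultimately show ?thesis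
    unfolding norm_factor_def by (simp only: mult_ac)
qed

text \<open>
  The normalising factors are chosen so that the Dirac masses, weighted by the kernel, have total
  mass one; hence the process is pinned at the origin and at \<open>b m\<close>.
\<close>

lemma endpoint_measure_eq_return:
  fixes b :: "nat ^ 'n \<Rightarrow> real ^ 'n"
  assumes "lam > 0" "T > 0"
  shows "endpoint_measure lam T b m = return (borel \<Otimes>\<^sub>M borel) (0, b m)"
proof (rule measure_eqI)
  show s: "sets (endpoint_measure lam T b m) = sets (return (borel \<Otimes>\<^sub>M borel) (0, b m))"
    unfolding endpoint_measure_def phi_0_def psi_T_def sets_density
    by (auto intro!: arg_cong[where f=sets] sets_pair_measure_cong simp del: sets_pair_measure)
  fix A assume "A \<in> sets (endpoint_measure lam T b m)"
  then have A[measurable]: "A \<in> sets (borel \<Otimes>\<^sub>M borel)" using s by simp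
  let ?c = "ennreal (norm_factor lam T (b m))"
  have f: "finite_measure (psi_T lam T b m)"
    by (rule finite_measureI) (simp add: psi_T_def space_scale_measure)
  interpret psi: finite_measure "psi_T lam T b m" by (rule f)
  have n0: "norm_factor lam T (b m) \<ge> 0" by (simp add: norm_factor_def)
  have sph[measurable_cong]: "sets (phi_0 lam T b m) = sets borel" "sets (psi_T lam T b m) = sets borel"
    by (simp_all add: phi_0_def psi_T_def)
  have "emeasure (endpoint_measure lam T b m) A
    = (\<integral>\<^sup>+ p. (case p of (x, y) \<Rightarrow> ennreal (mehler_kernel lam x T y)) * indicator A p
        \<partial>(phi_0 lam T b m \<Otimes>\<^sub>M psi_T lam T b m))"
    unfolding endpoint_measure_def by (rule emeasure_density) measurable
  also have "\<dots> = (\<integral>\<^sup>+ x. \<integral>\<^sup>+ y. ennreal (mehler_kernel lam x T y) * indicator A (x, y)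
        \<partial>psi_T lam T b m \<partial>phi_0 lam T b m)"
    by (subst psi.nn_integral_fst[symmetric]) simp_all
  also have "\<dots> = ?c * (?c * (ennreal (mehler_kernel lam 0 T (b m)) * indicator A (0, b m)))"
    unfolding phi_0_def psi_T_def
    by (simp add: nn_integral_scale_measure nn_integral_return)
  also have "\<dots> = ennreal (norm_factor lam T (b m) * norm_factor lam T (b m) * mehler_kernel lam 0 T (b m))
      * indicator A (0, b m)"
    using n0 assms by (simp add: ennreal_mult less_imp_le mult.assoc)
  also have "\<dots> = emeasure (return (borel \<Otimes>\<^sub>M borel) (0, b m)) A"
    unfolding mehler_kernel_norm_factor[OF assms] by simp
  finally show "emeasure (endpoint_measure lam T b m) A = emeasure (return (borel \<Otimes>\<^sub>M borel) (0, b m)) A" .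
qed

section \<open>Laws determined by characteristic functions\<close>

text \<open>
  Levy's uniqueness theorem identifies the law. Nonnegativity of \<open>V\<close> comes for free, since a
  characteristic function is bounded by one; this lets the degenerate case \<open>V = 0\<close> be treated
  uniformly with the others.
\<close>

lemma (in prob_space) normal_law_of_char:
  fixes X :: "'a \<Rightarrow> real"
  assumes X[measurable]: "X \<in> borel_measurable M"
    and char: "\<And>u. (CLINT \<omega>|M. iexp (u * X \<omega>)) = iexp (u * c) * complex_of_real (exp (- V * u\<^sup>2 / 2))"
  shows "V \<ge> 0"
    and "V = 0 \<Longrightarrow> AE \<omega> in M. X \<omega> = c"
    and "V > 0 \<Longrightarrow> distributed M lborel X (normal_density c (sqrt V))"
proof -
  have charX: "char (distr M borel X) u = iexp (u * c) * complex_of_real (exp (- V * u\<^sup>2 / 2))" for u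
    using char[of u] by (simp add: char_def integral_distr)
  interpret D: real_distribution "distr M borel X" by (rule real_distribution_distr) simp
  have "cmod (char (distr M borel X) 1) \<le> 1" by (rule D.cmod_char_le_1)
  then show "V \<ge> 0" unfolding charX by (simp add: norm_mult)
  { assume V: "V = 0"
    have "real_distribution (return borel c :: real measure)"
      by (intro real_distribution.intro real_distribution_axioms.intro prob_space_return) auto
    moreover have "char (distr M borel X) = char (return borel c)"
      by (rule ext, subst charX) (simp add: V char_def integral_return)
    ultimately have "distr M borel X = return borel c"
      using Levy_uniqueness D.real_distribution_axioms by blast
    then have "AE x in distr M borel X. x = c" by (simp only:) (simp add: AE_return)
    then show "AE \<omega> in M. X \<omega> = c" by (subst (asm) AE_distr_iff) auto }
  { assume V: "V > 0"
    then have s: "sqrt V > 0" by simp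
    have "real_distribution (density lborel (normal_density c (sqrt V)))"
      by (intro real_distribution.intro real_distribution_axioms.intro prob_space_normal_density[OF s]) auto
    moreover have "char (distr M borel X) = char (density lborel (normal_density c (sqrt V)))"
      using V char_normal[OF s, of c]
      by (intro ext, subst charX)
        (simp add: char_def integral_density normal_density_nonneg power_mult_distrib mult.commute)
    ultimately have "distr M borel X = density lborel (normal_density c (sqrt V))"
      using Levy_uniqueness D.real_distribution_axioms by blast
    then show "distributed M lborel X (normal_density c (sqrt V))"
      by (simp add: distributed_def cong: distr_cong) }
qed

lemma (in prob_space) second_moment_of_char:
  fixes X :: "'a \<Rightarrow> real"
  assumes X[measurable]: "X \<in> borel_measurable M"
    and char: "\<And>u. (CLINT \<omega>|M. iexp (u * X \<omega>)) = complex_of_real (exp (- V * u\<^sup>2 / 2))"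
  shows "has_bochner_integral M (\<lambda>\<omega>. (X \<omega>)\<^sup>2) V"
proof -
  have char0: "\<And>u. (CLINT \<omega>|M. iexp (u * X \<omega>)) = iexp (u * 0) * complex_of_real (exp (- V * u\<^sup>2 / 2))"
    using char by simp
  note law = normal_law_of_char[OF X char0]
  show ?thesis
  proof (cases "V = 0")
    case True
    then have "AE \<omega> in M. (X \<omega>)\<^sup>2 = 0" using law(2) by simp
    then show ?thesis using True has_bochner_integral_cong_AE[of "\<lambda>\<omega>. (X \<omega>)\<^sup>2" M "\<lambda>_. 0"] by auto
  next
    case False
    then have V: "V > 0" using law(1) by simp
    then have s: "sqrt V > 0" by simp
    have D: "distributed M lborel X (normal_density 0 (sqrt V))" using law(3)[OF V] .
    have "has_bochner_integral lborel (\<lambda>x. normal_density 0 (sqrt V) x * x\<^sup>2) V"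
      using normal_moment_even[OF s, of 0 1] V by simp
    then show ?thesis
      using distributed_integrable[OF D, of "\<lambda>x. x\<^sup>2"] distributed_integral[OF D, of "\<lambda>x. x\<^sup>2"]
      by (simp add: has_bochner_integral_iff normal_density_nonneg)
  qed
qed

section \<open>Conditioning\<close>

lemma space_generated_sigma [simp]: "space (generated_sigma M Z I) = space M"
  by (simp add: generated_sigma_def space_measure_of_conv)

lemma sets_generated_sigma:
  "sets (generated_sigma M Z I) = sigma_sets (space M) {Z \<tau> -` F \<inter> space M | \<tau> F. \<tau> \<in> I \<and> F \<in> sets borel}"
  unfolding generated_sigma_def by (rule sets_measure_of) auto

lemma subalgebra_generated_sigma:
  assumes "\<And>\<tau>. \<tau> \<in> I \<Longrightarrow> Z \<tau> \<in> borel_measurable M"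
  shows "subalgebra M (generated_sigma M Z I)"
  unfolding subalgebra_def sets_generated_sigma
  using assms by (auto intro!: sets.sigma_sets_subset measurable_sets)

lemma measurable_generated_sigma:
  assumes "\<tau> \<in> I"
  shows "Z \<tau> \<in> borel_measurable (generated_sigma M Z I)"
  using assms unfolding measurable_def sets_generated_sigma
  by (auto intro!: sigma_sets.Basic)

lemma sets_generated_sigma_mono:
  "I \<subseteq> J \<Longrightarrow> sets (generated_sigma M Z I) \<subseteq> sets (generated_sigma M Z J)"
  unfolding sets_generated_sigma by (intro sigma_sets_mono') blast

lemma sets_generated_sigma_single:
  "sets (generated_sigma M Z {s}) = {Z s -` F \<inter> space M | F. F \<in> sets borel}"
proof -
  have "sets (vimage_algebra (space M) (Z s) borel) = {Z s -` F \<inter> space M | F. F \<in> sets borel}"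
    by (rule sets_vimage_algebra2) simp
  then show ?thesis by (simp add: sets_vimage_algebra sets_generated_sigma)
qed

lemma sets_sigma_join:
  assumes "space B = space A"
  shows "sets (sigma_join A B) = sigma_sets (space A) (sets A \<union> sets B)" "space (sigma_join A B) = space A"
  using assms sets.space_closed[of A] sets.space_closed[of B]
  by (simp_all add: sigma_join_def sets_measure_of space_measure_of_conv)

lemma subalgebra_sigma_join:
  assumes "subalgebra M A" "subalgebra M B"
  shows "subalgebra M (sigma_join A B)"
  using assms sets.sigma_sets_subset[of "sets A \<union> sets B" M]
  by (auto simp: subalgebra_def sets_sigma_join)

text \<open>
  The sets that agree almost everywhere with a member of a given \<open>\<sigma>\<close>-algebra form a \<open>\<sigma>\<close>-algebra.
\<close>

lemma sigma_sets_AE_eq: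
  assumes A: "subalgebra M A"
    and gen: "\<And>e. e \<in> E \<Longrightarrow> \<exists>a\<in>sets A. AE \<omega> in M. \<omega> \<in> e \<longleftrightarrow> \<omega> \<in> a"
    and "B \<in> sigma_sets (space M) E"
  shows "\<exists>a\<in>sets A. AE \<omega> in M. \<omega> \<in> B \<longleftrightarrow> \<omega> \<in> a"
  using assms(3)
proof induction
  case (Basic e) then show ?case by (rule gen)
next
  case Empty then show ?case by (intro bexI[of _ "{}"]) auto
next
  case (Compl B)
  then obtain a where a: "a \<in> sets A" "AE \<omega> in M. \<omega> \<in> B \<longleftrightarrow> \<omega> \<in> a" by auto
  have "space M - a \<in> sets A" using A a(1) unfolding subalgebra_def by (metis sets.compl_sets)
  then show ?case using a(2) by (intro bexI[of _ "space M - a"]) auto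
next
  case (Union B)
  then obtain a where a: "\<And>i. a i \<in> sets A" "\<And>i::nat. AE \<omega> in M. \<omega> \<in> B i \<longleftrightarrow> \<omega> \<in> a i" by metis
  have "AE \<omega> in M. \<forall>i. \<omega> \<in> B i \<longleftrightarrow> \<omega> \<in> a i" using a(2) by (simp add: AE_all_countable)
  then show ?case using a(1) by (intro bexI[of _ "\<Union>i. a i"]) auto
qed

text \<open>
  Conditional expectations only see a \<open>\<sigma>\<close>-algebra up to null sets, because they are characterised
  by their integrals.
\<close>

lemma (in prob_space) real_cond_exp_AE_eq_subalgebra:
  assumes A: "subalgebra M A" and B: "subalgebra M B" and sub: "sets A \<subseteq> sets B"
    and eq: "\<And>b. b \<in> sets B \<Longrightarrow> \<exists>a\<in>sets A. AE \<omega> in M. \<omega> \<in> b \<longleftrightarrow> \<omega> \<in> a"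
    and f: "integrable M f"
  shows "AE \<omega> in M. real_cond_exp M B f \<omega> = real_cond_exp M A f \<omega>"
proof -
  interpret A: finite_measure_subalgebra M A by unfold_locales (rule A)
  interpret B: finite_measure_subalgebra M B by unfold_locales (rule B)
  have fm[measurable]: "f \<in> borel_measurable M" using f by auto
  have AB: "subalgebra B A" using A B sub by (auto simp: subalgebra_def)
  show ?thesis
  proof (rule B.real_cond_exp_charact)
    fix b assume b: "b \<in> sets B"
    then obtain a where a: "a \<in> sets A" "AE \<omega> in M. \<omega> \<in> b \<longleftrightarrow> \<omega> \<in> a" using eq by auto
    have [measurable]: "a \<in> sets M" "b \<in> sets M" using a(1) b A B by (auto simp: subalgebra_def)
    have *: "(\<integral>\<omega>\<in>b. g \<omega> \<partial>M) = (\<integral>\<omega>\<in>a. g \<omega> \<partial>M)" if [measurable]: "g \<in> borel_measurable M" for g :: "'a \<Rightarrow> real"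
      unfolding set_lebesgue_integral_def
      by (rule integral_cong_AE) (use a(2) in \<open>auto split: split_indicator\<close>)
    show "(\<integral>\<omega>\<in>b. f \<omega> \<partial>M) = (\<integral>\<omega>\<in>b. real_cond_exp M A f \<omega> \<partial>M)"
      using A.real_cond_exp_intA[OF f a(1)] by (simp add: *)
  qed (use f A.real_cond_exp_int measurable_from_subalg[OF AB borel_measurable_cond_exp] in auto)
qed

lemma (in prob_space) complex_cond_exp_AE_eq_subalgebra:
  assumes "subalgebra M A" "subalgebra M B" "sets A \<subseteq> sets B"
    and "\<And>b. b \<in> sets B \<Longrightarrow> \<exists>a\<in>sets A. AE \<omega> in M. \<omega> \<in> b \<longleftrightarrow> \<omega> \<in> a"
    and "integrable M f"
  shows "AE \<omega> in M. complex_cond_exp M B f \<omega> = complex_cond_exp M A f \<omega>"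
  using real_cond_exp_AE_eq_subalgebra[OF assms(1-4), of "\<lambda>\<omega>. Re (f \<omega>)"]
    real_cond_exp_AE_eq_subalgebra[OF assms(1-4), of "\<lambda>\<omega>. Im (f \<omega>)"] assms(5)
  by (auto simp: complex_cond_exp_def)

text \<open>
  The version \<open>g\<close> of \<open>f\<close> is there for random variables that are almost surely constant: \<open>g\<close> is then the
  constant.
\<close>

lemma (in prob_space) complex_cond_exp_measurable:
  assumes A: "subalgebra M A" and f: "integrable M f" and g: "g \<in> borel_measurable A"
    and fg: "AE \<omega> in M. f \<omega> = g \<omega>"
  shows "AE \<omega> in M. complex_cond_exp M A f \<omega> = g \<omega>"
proof -
  interpret A: finite_measure_subalgebra M A by unfold_locales (rule A)
  note [measurable] = g measurable_from_subalg[OF A g] borel_measurable_integrable[OF f]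
  have ig: "integrable M g" using f by (rule integrable_cong_AE_imp) (use fg in auto)
  have "AE \<omega> in M. real_cond_exp M A (\<lambda>\<omega>. Re (f \<omega>)) \<omega> = real_cond_exp M A (\<lambda>\<omega>. Re (g \<omega>)) \<omega>"
    "AE \<omega> in M. real_cond_exp M A (\<lambda>\<omega>. Im (f \<omega>)) \<omega> = real_cond_exp M A (\<lambda>\<omega>. Im (g \<omega>)) \<omega>"
    by (rule A.real_cond_exp_cong; use fg in auto)+
  moreover have "AE \<omega> in M. real_cond_exp M A (\<lambda>\<omega>. Re (g \<omega>)) \<omega> = Re (g \<omega>)"
    "AE \<omega> in M. real_cond_exp M A (\<lambda>\<omega>. Im (g \<omega>)) \<omega> = Im (g \<omega>)"
    using ig by (auto intro!: A.real_cond_exp_F_meas)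
  ultimately show ?thesis by (auto simp: complex_cond_exp_def)
qed

text \<open>
  In the Bernstein property for the times \<open>s < t < T\<close> the future from \<open>T\<close> on is generated by \<open>Z T\<close> alone.
  If this variable is almost surely constant, it adds only sets of probability zero or one to the past
  of \<open>s\<close> and to the present \<open>Z s\<close>, and dropping it turns the Bernstein property into the Markov property.
\<close>

lemma bernstein_imp_markov_if_terminal_const:
  fixes Z :: "real \<Rightarrow> 'w \<Rightarrow> real ^ 'n"
  assumes Z: "bernstein_process T M Z" and ZT: "AE \<omega> in M. Z T \<omega> = c"
  shows "markov_process T M Z"
  unfolding markov_process_def
proof (intro allI impI)
  fix s t and f :: "real ^ 'n \<Rightarrow> complex"
  assume st: "0 \<le> s \<and> s \<le> t \<and> t \<le> T" and f: "f \<in> borel_measurable borel \<and> bounded (range f)"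
  interpret prob_space M using Z by (simp add: bernstein_process_def)
  have Zm: "\<tau> \<in> {0..T} \<Longrightarrow> Z \<tau> \<in> borel_measurable M" for \<tau> using Z by (simp add: bernstein_process_def)
  note [measurable] = conjunct1[OF f]
  let ?G = "\<lambda>I. generated_sigma M Z I"
  have sub: "subalgebra M (?G I)" if "I \<subseteq> {0..T}" for I
    using that by (intro subalgebra_generated_sigma Zm) auto
  have s1: "subalgebra M (?G {0..s})" "subalgebra M (?G {s})" "subalgebra M (?G {T..T})" "subalgebra M (?G {s,T})"
    using st by (auto intro!: sub)
  obtain K where K: "\<And>x. norm (f x) \<le> K" using f by (auto simp: bounded_iff)
  have int: "integrable M (\<lambda>\<omega>. f (Z t \<omega>))"
    using st K Zm[of t] by (intro integrable_const_bound[of _ K]) auto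
  consider "t = s" | "t = T" | "s < t" "t < T" using st by linarith
  then show "AE \<omega> in M. complex_cond_exp M (?G {0..s}) (\<lambda>\<omega>. f (Z t \<omega>)) \<omega> =
      complex_cond_exp M (?G {s}) (\<lambda>\<omega>. f (Z t \<omega>)) \<omega>"
  proof cases
    case 1
    have "AE \<omega> in M. complex_cond_exp M (?G I) (\<lambda>\<omega>. f (Z t \<omega>)) \<omega> = f (Z t \<omega>)"
      if "s \<in> I" "subalgebra M (?G I)" for I
      using 1 measurable_generated_sigma[OF that(1), of Z M] that int
      by (intro complex_cond_exp_measurable) auto
    from this[of "{0..s}"] this[of "{s}"] show ?thesis using st s1 by auto
  next
    case 2
    have "AE \<omega> in M. complex_cond_exp M (?G I) (\<lambda>\<omega>. f (Z t \<omega>)) \<omega> = f c" if "subalgebra M (?G I)" for I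
      using 2 that int ZT by (intro complex_cond_exp_measurable) auto
    from this[of "{0..s}"] this[of "{s}"] show ?thesis using st s1 by auto
  next
    case 3
    have trivial: "\<exists>a\<in>sets A. AE \<omega> in M. \<omega> \<in> Z T -` F \<inter> space M \<longleftrightarrow> \<omega> \<in> a"
      if "subalgebra M A" for A F
    proof (cases "c \<in> F")
      case True
      then show ?thesis using ZT that sets.top[of A] by (intro bexI[of _ "space M"]) (auto simp: subalgebra_def)
    next
      case False
      then show ?thesis using ZT by (intro bexI[of _ "{}"]) auto
    qed
    have B: "AE \<omega> in M. complex_cond_exp M (sigma_join (?G {0..s}) (?G {T..T})) (\<lambda>\<omega>. f (Z t \<omega>)) \<omega>
        = complex_cond_exp M (?G {s,T}) (\<lambda>\<omega>. f (Z t \<omega>)) \<omega>"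
      by (rule Z[unfolded bernstein_process_def, THEN conjunct2, THEN conjunct2, THEN conjunct2, rule_format, OF _ f, of s t T])
        (intro conjI order_refl 3 st[THEN conjunct1])
    have J: "subalgebra M (sigma_join (?G {0..s}) (?G {T..T}))" using s1 by (intro subalgebra_sigma_join)
    have "AE \<omega> in M. complex_cond_exp M (sigma_join (?G {0..s}) (?G {T..T})) (\<lambda>\<omega>. f (Z t \<omega>)) \<omega>
        = complex_cond_exp M (?G {0..s}) (\<lambda>\<omega>. f (Z t \<omega>)) \<omega>"
    proof (rule complex_cond_exp_AE_eq_subalgebra[OF s1(1) J _ _ int])
      show "sets (?G {0..s}) \<subseteq> sets (sigma_join (?G {0..s}) (?G {T..T}))"
        by (auto simp: sets_sigma_join)
      fix B assume "B \<in> sets (sigma_join (?G {0..s}) (?G {T..T}))"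
      then have "B \<in> sigma_sets (space M) (sets (?G {0..s}) \<union> sets (?G {T}))"
        by (simp add: sets_sigma_join)
      then show "\<exists>a\<in>sets (?G {0..s}). AE \<omega> in M. \<omega> \<in> B \<longleftrightarrow> \<omega> \<in> a"
      proof (rule sigma_sets_AE_eq[OF s1(1), rotated])
        fix e assume "e \<in> sets (?G {0..s}) \<union> sets (?G {T})"
        then consider "e \<in> sets (?G {0..s})" | F where "e = Z T -` F \<inter> space M"
          unfolding sets_generated_sigma_single by blast
        then show "\<exists>a\<in>sets (?G {0..s}). AE \<omega> in M. \<omega> \<in> e \<longleftrightarrow> \<omega> \<in> a"
          by cases (rule bexI[of _ e], simp_all only: AE_I2, use trivial[OF s1(1)] in blast)
      qed
    qed
    moreover have "AE \<omega> in M. complex_cond_exp M (?G {s,T}) (\<lambda>\<omega>. f (Z t \<omega>)) \<omega>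
        = complex_cond_exp M (?G {s}) (\<lambda>\<omega>. f (Z t \<omega>)) \<omega>"
    proof (rule complex_cond_exp_AE_eq_subalgebra[OF s1(2,4) _ _ int])
      show "sets (?G {s}) \<subseteq> sets (?G {s,T})" by (rule sets_generated_sigma_mono) auto
      fix B assume "B \<in> sets (?G {s,T})"
      then have "B \<in> sigma_sets (space M) {Z \<tau> -` F \<inter> space M | \<tau> F. \<tau> \<in> {s,T} \<and> F \<in> sets borel}"
        unfolding sets_generated_sigma .
      then show "\<exists>a\<in>sets (?G {s}). AE \<omega> in M. \<omega> \<in> B \<longleftrightarrow> \<omega> \<in> a"
      proof (rule sigma_sets_AE_eq[OF s1(2), rotated])
        fix e assume "e \<in> {Z \<tau> -` F \<inter> space M | \<tau> F. \<tau> \<in> {s,T} \<and> F \<in> sets borel}"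
        then consider "e \<in> sets (?G {s})" | F where "e = Z T -` F \<inter> space M"
          unfolding sets_generated_sigma_single by blast
        then show "\<exists>a\<in>sets (?G {s}). AE \<omega> in M. \<omega> \<in> e \<longleftrightarrow> \<omega> \<in> a"
          by cases (rule bexI[of _ e], simp_all only: AE_I2, use trivial[OF s1(2)] in blast)
      qed
    qed
    ultimately show ?thesis using B by auto
  qed
qed

section \<open>Transition densities\<close>

text \<open>
  The hypothesis \<open>law\<close> says that \<open>q \<omega>\<close> is a density of the conditional law of \<open>Y\<close> given \<open>A\<close>, tested on
  rectangles. Rectangles determine the joint law of \<open>(\<omega>, Y \<omega>)\<close>, where \<open>\<omega>\<close> is observed through \<open>A\<close> only,
  so the conclusion is Fubini's theorem. Keeping \<open>\<omega>\<close> itself as the first coordinate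
  makes it possible to average functions of the whole past and of \<open>Y\<close> at once.
\<close>

lemma (in prob_space) expectation_of_transition_density:
  fixes Y :: "'a \<Rightarrow> 'b::euclidean_space" and q :: "'a \<Rightarrow> 'b \<Rightarrow> real" and H :: "'a \<Rightarrow> 'b \<Rightarrow> complex"
  assumes A: "subalgebra M A" and Y[measurable]: "Y \<in> borel_measurable M"
    and q[measurable]: "case_prod q \<in> borel_measurable (A \<Otimes>\<^sub>M borel)" and q0: "\<And>\<omega> z. 0 \<le> q \<omega> z"
    and law: "\<And>a C. a \<in> sets A \<Longrightarrow> C \<in> sets borel \<Longrightarrow>
      emeasure M (a \<inter> (Y -` C \<inter> space M)) = (\<integral>\<^sup>+\<omega>. indicator a \<omega> * (\<integral>\<^sup>+z. ennreal (q \<omega> z) * indicator C z \<partial>lborel) \<partial>M)"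
    and H[measurable]: "case_prod H \<in> borel_measurable (A \<Otimes>\<^sub>M borel)" and bdd: "\<And>\<omega> z. norm (H \<omega> z) \<le> K"
  shows "(\<integral>\<omega>. H \<omega> (Y \<omega>) \<partial>M) = (\<integral>\<omega>. (\<integral>z. q \<omega> z *\<^sub>R H \<omega> z \<partial>lborel) \<partial>M)"
proof -
  let ?R = "restr_to_subalg M A"
  let ?P = "?R \<Otimes>\<^sub>M (lborel :: 'b measure)"
  let ?E = "{a \<times> b |a b. a \<in> sets A \<and> b \<in> sets (borel :: 'b measure)}"
  interpret R: finite_measure ?R
    by (rule finite_measure_restr_to_subalg[OF A]) unfold_locales
  interpret P: pair_sigma_finite ?R "lborel :: 'b measure" ..
  have spA: "space A = space M" and setsA: "sets A \<subseteq> sets M" using A by (auto simp: subalgebra_def)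
  have setsP[measurable_cong]: "sets ?P = sets (A \<Otimes>\<^sub>M borel)"
    by (intro sets_pair_measure_cong) (simp_all add: sets_restr_to_subalg[OF A])
  have idA[measurable]: "(\<lambda>\<omega>. \<omega>) \<in> measurable M A"
    using spA setsA by (auto simp: measurable_def)
  have pair[measurable]: "(\<lambda>\<omega>. (\<omega>, Y \<omega>)) \<in> measurable M (A \<Otimes>\<^sub>M borel)" by measurable
  have pairP: "(\<lambda>\<omega>. (\<omega>, Y \<omega>)) \<in> measurable M ?P"
    using pair by (simp only: measurable_cong_sets[OF refl setsP])
  have Qm: "(\<lambda>p. ennreal (case_prod q p)) \<in> borel_measurable ?P" by measurable
  have joint: "distr M ?P (\<lambda>\<omega>. (\<omega>, Y \<omega>)) = density ?P (\<lambda>p. ennreal (case_prod q p))" (is "?L = ?D")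
  proof (rule measure_eqI_generator_eq[OF Int_stable_pair_measure_generator[of A "borel :: 'b measure"], where A="\<lambda>_. space A \<times> UNIV"])
    show "?E \<subseteq> Pow (space A \<times> UNIV)"
      using sets.sets_into_space by fastforce
    show "sets ?L = sigma_sets (space A \<times> UNIV) ?E"
      "sets ?D = sigma_sets (space A \<times> UNIV) ?E"
      using setsP by (simp_all add: sets_pair_measure)
    show "range (\<lambda>_::nat. space A \<times> UNIV) \<subseteq> ?E"
      by (intro image_subsetI CollectI exI[of _ "space A"] exI[of _ UNIV]) simp
    show "(\<Union>i::nat. space A \<times> UNIV) = space A \<times> UNIV" by simp
    have pr: "prob_space ?L" by (rule prob_space_distr[OF pairP])
    show "emeasure ?L (space A \<times> UNIV) \<noteq> \<infinity>" for i :: nat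
      using finite_measure.emeasure_finite[OF prob_space.axioms(1)[OF pr]] by auto
    fix X assume "X \<in> ?E"
    then obtain a C where X: "X = a \<times> C" and [measurable]: "a \<in> sets A" "C \<in> sets borel" by auto
    have aC: "a \<times> C \<in> sets ?P" unfolding setsP by measurable
    have "emeasure ?L X = emeasure M (a \<inter> (Y -` C \<inter> space M))"
      unfolding X emeasure_distr[OF pairP aC] by (auto intro!: arg_cong[where f="emeasure M"])
    also have "\<dots> = (\<integral>\<^sup>+\<omega>. indicator a \<omega> * (\<integral>\<^sup>+z. ennreal (q \<omega> z) * indicator C z \<partial>lborel) \<partial>M)"
      by (rule law) measurable
    also have "\<dots> = (\<integral>\<^sup>+\<omega>. indicator a \<omega> * (\<integral>\<^sup>+z. ennreal (q \<omega> z) * indicator C z \<partial>lborel) \<partial>?R)"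
      by (rule nn_integral_subalgebra2[symmetric, OF A]) measurable
    also have "\<dots> = (\<integral>\<^sup>+\<omega>. (\<integral>\<^sup>+z. ennreal (case_prod q (\<omega>, z)) * indicator (a \<times> C) (\<omega>, z) \<partial>lborel) \<partial>?R)"
      proof (rule nn_integral_cong)
      show "indicator a \<omega> * (\<integral>\<^sup>+z. ennreal (q \<omega> z) * indicator C z \<partial>lborel)
          = (\<integral>\<^sup>+z. ennreal (case_prod q (\<omega>, z)) * indicator (a \<times> C) (\<omega>, z) \<partial>lborel)" for \<omega>
        by (cases "\<omega> \<in> a") (simp_all add: indicator_times)
    qed
    also have "\<dots> = (\<integral>\<^sup>+p. ennreal (case_prod q p) * indicator (a \<times> C) p \<partial>?P)"
      by (rule lborel.nn_integral_fst) measurable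
    also have "\<dots> = emeasure ?D X" unfolding X by (rule emeasure_density[symmetric, OF Qm aC])
    finally show "emeasure ?L X = emeasure ?D X" .
  qed
  have Hm: "case_prod H \<in> borel_measurable ?P" by measurable
  have "integrable M (\<lambda>\<omega>. case_prod H (\<omega>, Y \<omega>))"
    using bdd by (intro integrable_const_bound[of _ K]) auto
  then have "integrable ?L (case_prod H)" by (simp only: integrable_distr_eq[OF pairP Hm])
  then have int: "integrable ?P (\<lambda>p. case_prod q p *\<^sub>R case_prod H p)"
    unfolding joint using q0 by (subst (asm) integrable_density) auto
  have "(\<integral>\<omega>. H \<omega> (Y \<omega>) \<partial>M) = integral\<^sup>L ?L (case_prod H)"
    by (simp only: integral_distr[OF pairP Hm] prod.case)
  also have "\<dots> = (\<integral>p. case_prod q p *\<^sub>R case_prod H p \<partial>?P)"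
    unfolding joint using q0 by (subst integral_density) auto
  also have "\<dots> = (\<integral>\<omega>. (\<integral>z. q \<omega> z *\<^sub>R H \<omega> z \<partial>lborel) \<partial>?R)"
    using P.integral_fst'[OF int] by simp
  also have "\<dots> = (\<integral>\<omega>. (\<integral>z. q \<omega> z *\<^sub>R H \<omega> z \<partial>lborel) \<partial>M)"
    by (rule integral_subalgebra2[OF A]) measurable
  finally show ?thesis .
qed

section \<open>Covariance forms\<close>

text \<open>
  For finite \<open>J\<close>, this is the covariance of \<open>\<Sum>r\<in>J. a r \<bullet> X r\<close> and \<open>\<Sum>q\<in>J. d q \<bullet> X q\<close> when the vectors
  \<open>X r\<close> are centred and the cross-covariance matrix of \<open>X r\<close> and \<open>X q\<close> is \<open>C r q\<close> times the identity.
\<close>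

definition cov_form :: "(real \<Rightarrow> real \<Rightarrow> real) \<Rightarrow> real set \<Rightarrow> (real \<Rightarrow> 'a::real_inner) \<Rightarrow> (real \<Rightarrow> 'a) \<Rightarrow> real" where
  "cov_form C J a d = (\<Sum>r\<in>J. \<Sum>q\<in>J. C r q * (a r \<bullet> d q))"

lemma cov_form_add_left: "cov_form C J (\<lambda>r. a r + a' r) d = cov_form C J a d + cov_form C J a' d"
  by (simp add: cov_form_def inner_add_left distrib_left sum.distrib)

lemma cov_form_add_right: "cov_form C J a (\<lambda>r. d r + d' r) = cov_form C J a d + cov_form C J a d'"
  by (simp add: cov_form_def inner_add_right distrib_left sum.distrib)

lemma cov_form_scaleR: "cov_form C J (\<lambda>r. u *\<^sub>R a r) (\<lambda>r. u *\<^sub>R a r) = u\<^sup>2 * cov_form C J a a"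
  by (simp add: cov_form_def sum_distrib_left power2_eq_square mult_ac)

lemma cov_form_commute:
  assumes "\<And>r q. C r q = C q r"
  shows "cov_form C J a d = cov_form C J d a"
  unfolding cov_form_def by (subst sum.swap) (simp add: inner_commute assms)

lemma cov_form_point:
  assumes "finite J" "s \<in> J"
  shows "cov_form C J a (\<lambda>r. if r = s then w else 0) = (\<Sum>r\<in>J. C r s * (a r \<bullet> w))"
  unfolding cov_form_def
proof (rule sum.cong[OF refl])
  fix r assume "r \<in> J"
  have "(\<Sum>q\<in>J. C r q * (a r \<bullet> (if q = s then w else 0))) = (\<Sum>q\<in>J. if q = s then C r q * (a r \<bullet> w) else 0)"
    by (rule sum.cong) auto
  then show "(\<Sum>q\<in>J. C r q * (a r \<bullet> (if q = s then w else 0))) = C r s * (a r \<bullet> w)"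
    using assms by simp
qed

lemma cov_form_point_point:
  assumes "finite J" "s \<in> J" "t \<in> J"
  shows "cov_form C J (\<lambda>r. if r = s then v else 0) (\<lambda>r. if r = t then w else 0) = C s t * (v \<bullet> w)"
proof -
  have "(\<Sum>r\<in>J. C r t * ((if r = s then v else 0) \<bullet> w)) = (\<Sum>r\<in>J. if r = s then C r t * (v \<bullet> w) else 0)"
    by (rule sum.cong) auto
  then show ?thesis using assms by (simp add: cov_form_point)
qed

text \<open>
  This mirrors the recursion \<open>X t = \<alpha> X s + \<xi>\<close> with \<open>\<xi>\<close> of variance \<open>v\<close> and independent of the
  \<open>X r\<close>, \<open>r \<in> J\<close>: the coefficient \<open>a t\<close> of the new time is passed on to time \<open>s\<close> with weight \<open>\<alpha>\<close>.
\<close>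

lemma cov_form_insert:
  fixes a :: "real \<Rightarrow> 'a::real_inner"
  assumes J: "finite J" "s \<in> J" "t \<notin> J" and sym: "\<And>r q. C r q = C q r"
    and past: "\<And>r. r \<in> J \<Longrightarrow> \<alpha> * C r s = C r t" and new: "C t t = \<alpha>\<^sup>2 * C s s + v"
  shows "cov_form C (insert t J) a a
    = cov_form C J (\<lambda>r. a r + (if r = s then \<alpha> *\<^sub>R a t else 0)) (\<lambda>r. a r + (if r = s then \<alpha> *\<^sub>R a t else 0))
      + v * (a t \<bullet> a t)"
proof -
  let ?d = "\<lambda>r. if r = s then \<alpha> *\<^sub>R a t else 0"
  let ?X = "\<Sum>r\<in>J. C r t * (a r \<bullet> a t)"
  have "cov_form C J a ?d = (\<Sum>r\<in>J. (\<alpha> * C r s) * (a r \<bullet> a t))"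
    unfolding cov_form_point[OF J(1,2)] by (simp add: mult_ac)
  then have cross: "cov_form C J a ?d = ?X" using past by simp
  have "cov_form C J ?d ?d = \<alpha>\<^sup>2 * C s s * (a t \<bullet> a t)"
    unfolding cov_form_point_point[OF J(1,2,2)] by (simp add: power2_eq_square)
  moreover have "cov_form C (insert t J) a a = cov_form C J a a + 2 * ?X + C t t * (a t \<bullet> a t)"
  proof -
    have "(\<Sum>q\<in>J. C t q * (a t \<bullet> a q)) = ?X"
      by (rule sum.cong) (simp_all add: sym[of t] inner_commute[of "a t"])
    then show ?thesis using J by (simp add: cov_form_def sum.distrib)
  qed
  ultimately show ?thesis
    using cross cov_form_commute[of C J ?d a, OF sym]
    by (simp add: cov_form_add_left cov_form_add_right new algebra_simps)
qed

section \<open>The bridge covariance\<close>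

definition bridge_cov :: "real \<Rightarrow> real \<Rightarrow> real \<Rightarrow> real \<Rightarrow> real" where
  "bridge_cov lam T s t = sinh (lam * (T - max s t)) * sinh (lam * min s t) / (lam * sinh (lam * T))"

text \<open>
  The factor by which the conditional mean of the centred process contracts from time \<open>s\<close> to time \<open>t\<close>.
\<close>

definition bridge_decay :: "real \<Rightarrow> real \<Rightarrow> real \<Rightarrow> real \<Rightarrow> real" where
  "bridge_decay lam T s t = sinh (lam * (T - t)) / sinh (lam * (T - s))"

lemma bridge_cov_commute: "bridge_cov lam T s t = bridge_cov lam T t s"
  by (simp add: bridge_cov_def max.commute min.commute)

lemma bridge_var_eq_pinned_var: "bridge_var lam T t = pinned_var lam t (T - t)"
  by (simp add: bridge_var_def pinned_var_def mult.commute)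

lemma bridge_mean_eq_pinned_mean: "bridge_mean lam T b m t = pinned_mean lam t (T - t) 0 (b m)"
  by (simp add: bridge_mean_def pinned_mean_def)

lemma sinh_three_term:
  fixes lam :: real
  shows "sinh (lam * t) * sinh (lam * (T - s))
    = sinh (lam * (T - t)) * sinh (lam * s) + sinh (lam * (t - s)) * sinh (lam * T)"
proof -
  have "cosh (lam * x) * cosh (lam * x) = 1 + sinh (lam * x) * sinh (lam * x)" for x
    using cosh_square_eq[of "lam * x"] by (simp add: power2_eq_square)
  note [simp] = this
  show ?thesis by (simp add: right_diff_distrib sinh_diff algebra_simps)
qed

lemma bridge_cov_past:
  assumes "lam > 0" "s < T" "r \<le> s" "s \<le> t"
  shows "bridge_decay lam T s t * bridge_cov lam T r s = bridge_cov lam T r t"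
  using assms by (simp add: bridge_decay_def bridge_cov_def max_absorb2 min_absorb1)

text \<open>
  The variance at time \<open>t\<close> splits into the part inherited from time \<open>s\<close> and the variance of the transition.
\<close>

lemma bridge_cov_new:
  assumes "lam > 0" "0 < T" "s < T" "s \<le> t"
  shows "bridge_cov lam T t t = (bridge_decay lam T s t)\<^sup>2 * bridge_cov lam T s s + pinned_var lam (t - s) (T - t)"
proof -
  define A B D E where "A = sinh (lam * (T - t))" and "B = sinh (lam * (T - s))"
    and "D = sinh (lam * T)" and "E = lam"
  have pos: "B > 0" "D > 0" "E > 0" using assms by (simp_all add: B_def D_def E_def)
  have "A * (sinh (lam * t) * B) = A * (A * sinh (lam * s) + sinh (lam * (t - s)) * D)"
    unfolding A_def B_def D_def by (subst sinh_three_term[of lam t T s]) simp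
  then have "A * sinh (lam * t) / (E * D)
    = (A / B)\<^sup>2 * (B * sinh (lam * s) / (E * D)) + sinh (lam * (t - s)) * A / (E * B)"
    using pos by (simp add: field_simps power2_eq_square)
  then show ?thesis
    by (simp add: bridge_cov_def bridge_decay_def pinned_var_def A_def B_def D_def E_def)
qed

text \<open>
  The transition mean is affine in the present position and fixes the curve of means; centring makes it linear.
\<close>

lemma pinned_mean_minus_bridge_mean:
  assumes "lam > 0" "0 < T" "s < T"
  shows "pinned_mean lam (t - s) (T - t) x (b m) - bridge_mean lam T b m t
    = bridge_decay lam T s t *\<^sub>R (x - bridge_mean lam T b m s)"
proof -
  have pos: "sinh (lam * (T - s)) > 0" "sinh (lam * T) > 0" using assms by simp_all
  have "sinh (lam * (t - s)) / sinh (lam * (T - s)) - sinh (lam * t) / sinh (lam * T)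
    = - (sinh (lam * (T - t)) / sinh (lam * (T - s)) * (sinh (lam * s) / sinh (lam * T)))"
  proof -
    have "P / B - X / D = - (A / B * (S / D))" if "X * B = A * S + P * D" "B > 0" "D > 0" for A B D P S X :: real
      using that by (simp add: field_simps)
    then show ?thesis using sinh_three_term[of lam t T s] pos by blast
  qed
  then have "(sinh (lam * (t - s)) / sinh (lam * (T - s))) *\<^sub>R b m - (sinh (lam * t) / sinh (lam * T)) *\<^sub>R b m
    = - (sinh (lam * (T - t)) / sinh (lam * (T - s)) * (sinh (lam * s) / sinh (lam * T))) *\<^sub>R b m"
    by (simp only: scaleR_left_diff_distrib[symmetric])
  then show ?thesis
    by (simp add: pinned_mean_def bridge_mean_def bridge_decay_def scaleR_right_diff_distrib)
qed

section \<open>Finite-dimensional distributions\<close>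

text \<open>
  The complement of the atom is a null set, so every integrand agrees almost everywhere with a constant.
  The lemma serves to evaluate iterated integrals, as functions of the endpoints, at the pinned pair.
\<close>

lemma nn_integral_return_singleton:
  assumes "x \<in> space M" "{x} \<in> sets M"
  shows "(\<integral>\<^sup>+y. g y \<partial>return M x) = g x"
proof -
  interpret prob_space "return M x" by (rule prob_space_return[OF assms(1)])
  have "Measurable.pred M (\<lambda>y. y = x)"
    unfolding pred_def using assms by (simp add: Collect_conv_if2 conj_commute cong: conj_cong)
  then have "AE y in return M x. y = x" using assms(1) by (subst AE_return) auto
  then have "(\<integral>\<^sup>+y. g y \<partial>return M x) = (\<integral>\<^sup>+y. g x \<partial>return M x)"
    by (intro nn_integral_cong_AE) auto
  then show ?thesis using emeasure_space_1 by simp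
qed

locale dirac_bernstein =
  fixes lam T :: real and b :: "nat ^ 'n \<Rightarrow> real ^ 'n" and m :: "nat ^ 'n"
    and M :: "'w measure" and Z :: "real \<Rightarrow> 'w \<Rightarrow> real ^ 'n"
  assumes lam: "lam > 0" and T: "T > 0"
    and assoc: "associated_bernstein_process lam T (endpoint_measure lam T b m) M Z"
begin

lemma bernstein: "bernstein_process T M Z"
  using assoc by (simp add: associated_bernstein_process_def)

sublocale prob_space M
  using bernstein by (simp add: bernstein_process_def)

lemma Z_measurable: "\<tau> \<in> {0..T} \<Longrightarrow> Z \<tau> \<in> borel_measurable M"
  using bernstein by (simp add: bernstein_process_def)

lemma fdd:
  assumes "n \<ge> 1" "t 0 = 0" "\<And>k. k < n \<Longrightarrow> t k < t (Suc k)" "t n < T"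
    and "\<And>k. k \<le> n \<Longrightarrow> F k \<in> sets borel" "FT \<in> sets borel"
  shows "emeasure M {\<omega> \<in> space M. (\<forall>k\<le>n. Z (t k) \<omega> \<in> F k) \<and> Z T \<omega> \<in> FT}
    = iterated_integral F n
        (\<lambda>x. ennreal ((\<Prod>k=1..n. mehler_kernel lam (x k) (t k - t (k - 1)) (x (k - 1))) *
                       mehler_kernel lam (b m) (T - t n) (x n))) (\<lambda>_. 0)
      / ennreal (mehler_kernel lam 0 T (b m)) * (indicator (F 0) 0 * indicator FT (b m))"
proof -
  have sg: "{(0 :: real ^ 'n, b m)} \<in> sets (borel \<Otimes>\<^sub>M borel)" by (intro sets_Pair) auto
  note law = assoc[unfolded associated_bernstein_process_def endpoint_measure_eq_return[OF lam T],
      THEN conjunct2, rule_format, of n t F FT]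
  show ?thesis
    using assms by (subst law) (auto simp: nn_integral_return_singleton[OF _ sg] space_pair_measure indicator_times)
qed

abbreviation transition_density :: "real \<Rightarrow> real \<Rightarrow> real ^ 'n \<Rightarrow> real ^ 'n \<Rightarrow> real" where
  "transition_density s t x \<equiv> isotropic_normal (pinned_mean lam (t - s) (T - t) x (b m)) (pinned_var lam (t - s) (T - t))"

text \<open>
  Here the Mehler factors of the defining formula collapse, by the pinning identity, to the density of the
  bridge that starts at the origin at time zero. Both endpoints are kept in the event, since the almost
  sure endpoint values are read off from it.
\<close>

lemma one_time_law:
  assumes "0 < t" "t < T" and [measurable]: "F0 \<in> sets borel" "F1 \<in> sets borel" "FT \<in> sets borel"
  shows "emeasure M {\<omega> \<in> space M. Z 0 \<omega> \<in> F0 \<and> Z t \<omega> \<in> F1 \<and> Z T \<omega> \<in> FT}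
    = (\<integral>\<^sup>+z. ennreal (transition_density 0 t 0 z) * indicator F1 z \<partial>lborel) * (indicator F0 0 * indicator FT (b m))"
proof -
  let ?g = "mehler_kernel lam 0 T (b m)"
  have g: "?g > 0" using lam T by simp
  have "emeasure M {\<omega> \<in> space M. Z 0 \<omega> \<in> F0 \<and> Z t \<omega> \<in> F1 \<and> Z T \<omega> \<in> FT}
    = emeasure M {\<omega> \<in> space M. (\<forall>k\<le>1. Z (if k = 0 then 0 else t) \<omega> \<in> (if k = (0::nat) then F0 else F1)) \<and> Z T \<omega> \<in> FT}"
    by (intro arg_cong[where f="emeasure M"]) (auto simp: le_Suc_eq)
  also have "\<dots> = (\<integral>\<^sup>+z\<in>F1. ennreal (mehler_kernel lam z t 0 * mehler_kernel lam (b m) (T - t) z) \<partial>lborel) / ennreal ?g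
      * (indicator F0 0 * indicator FT (b m))"
    using assms by (subst fdd) auto
  also have "(\<integral>\<^sup>+z\<in>F1. ennreal (mehler_kernel lam z t 0 * mehler_kernel lam (b m) (T - t) z) \<partial>lborel)
    = (\<integral>\<^sup>+z. ennreal ?g * (ennreal (transition_density 0 t 0 z) * indicator F1 z) \<partial>lborel)"
    using assms lam mehler_kernel_pinned[of lam t "T - t" _ 0 "b m"] mehler_kernel_commute[of lam 0 T "b m"]
    by (intro nn_integral_cong) (simp add: ennreal_mult mult.assoc less_imp_le)
  also have "\<dots> / ennreal ?g = (\<integral>\<^sup>+z. ennreal (transition_density 0 t 0 z) * indicator F1 z \<partial>lborel)"
    using g by (subst nn_integral_cmult) (auto simp: mult.commute[of "ennreal ?g"] mult_divide_eq_ennreal)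
  finally show ?thesis .
qed

text \<open>
  The pinning identity is applied twice: first at the later time, where it leaves the kernel that joins
  \<open>x\<close> to the terminal point, then at the earlier one.
\<close>

lemma two_time_law:
  assumes "0 < s" "s < t" "t < T"
    and [measurable]: "F0 \<in> sets borel" "F1 \<in> sets borel" "F2 \<in> sets borel" "FT \<in> sets borel"
  shows "emeasure M {\<omega> \<in> space M. Z 0 \<omega> \<in> F0 \<and> Z s \<omega> \<in> F1 \<and> Z t \<omega> \<in> F2 \<and> Z T \<omega> \<in> FT}
    = (\<integral>\<^sup>+x. ennreal (transition_density 0 s 0 x) *
          (indicator F1 x * (\<integral>\<^sup>+z. ennreal (transition_density s t x z) * indicator F2 z \<partial>lborel)) \<partial>lborel)
      * (indicator F0 0 * indicator FT (b m))"
proof -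
  let ?g = "mehler_kernel lam 0 T (b m)"
  have g: "?g > 0" using lam T by simp
  let ?t = "\<lambda>k. if k = 0 then 0 else if k = Suc 0 then s else t"
  let ?F = "\<lambda>k. if k = 0 then F0 else if k = Suc 0 then F1 else F2"
  have split: "mehler_kernel lam x s 0 * mehler_kernel lam z (t - s) x * mehler_kernel lam (b m) (T - t) z
    = ?g * transition_density 0 s 0 x * transition_density s t x z" for x z
    using assms lam mehler_kernel_pinned[of lam s "T - s" x 0 "b m"] mehler_kernel_pinned[of lam "t - s" "T - t" z x "b m"]
      mehler_kernel_commute[of lam 0 T "b m"]
    by (simp add: mult.assoc)
  have "emeasure M {\<omega> \<in> space M. Z 0 \<omega> \<in> F0 \<and> Z s \<omega> \<in> F1 \<and> Z t \<omega> \<in> F2 \<and> Z T \<omega> \<in> FT}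
    = emeasure M {\<omega> \<in> space M. (\<forall>k\<le>Suc (Suc 0). Z (?t k) \<omega> \<in> ?F k) \<and> Z T \<omega> \<in> FT}"
    by (intro arg_cong[where f="emeasure M"]) (auto simp: le_Suc_eq)
  also have "\<dots> = (\<integral>\<^sup>+x\<in>F1. (\<integral>\<^sup>+z\<in>F2. ennreal (mehler_kernel lam x s 0 * mehler_kernel lam z (t - s) x
        * mehler_kernel lam (b m) (T - t) z) \<partial>lborel) \<partial>lborel) / ennreal ?g * (indicator F0 0 * indicator FT (b m))"
    using assms by (subst fdd) (auto simp: less_Suc_eq prod.cl_ivl_Suc)
  also have "(\<integral>\<^sup>+x\<in>F1. (\<integral>\<^sup>+z\<in>F2. ennreal (mehler_kernel lam x s 0 * mehler_kernel lam z (t - s) x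
        * mehler_kernel lam (b m) (T - t) z) \<partial>lborel) \<partial>lborel)
    = (\<integral>\<^sup>+x. ennreal ?g * (ennreal (transition_density 0 s 0 x) *
          (indicator F1 x * (\<integral>\<^sup>+z. ennreal (transition_density s t x z) * indicator F2 z \<partial>lborel))) \<partial>lborel)"
    unfolding split
  proof (rule nn_integral_cong)
    fix x
    have "(\<integral>\<^sup>+z\<in>F2. ennreal (?g * transition_density 0 s 0 x * transition_density s t x z) \<partial>lborel)
      = (\<integral>\<^sup>+z. ennreal (?g * transition_density 0 s 0 x) * (ennreal (transition_density s t x z) * indicator F2 z) \<partial>lborel)"
      using g by (intro nn_integral_cong) (simp add: ennreal_mult mult.assoc less_imp_le)
    also have "\<dots> = ennreal (?g * transition_density 0 s 0 x) * (\<integral>\<^sup>+z. ennreal (transition_density s t x z) * indicator F2 z \<partial>lborel)"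
      by (rule nn_integral_cmult) measurable
    finally show "(\<integral>\<^sup>+z\<in>F2. ennreal (?g * transition_density 0 s 0 x * transition_density s t x z) \<partial>lborel) * indicator F1 x
      = ennreal ?g * (ennreal (transition_density 0 s 0 x) *
          (indicator F1 x * (\<integral>\<^sup>+z. ennreal (transition_density s t x z) * indicator F2 z \<partial>lborel)))"
      using g by (simp add: ennreal_mult less_imp_le mult_ac)
  qed
  also have "\<dots> / ennreal ?g = (\<integral>\<^sup>+x. ennreal (transition_density 0 s 0 x) *
          (indicator F1 x * (\<integral>\<^sup>+z. ennreal (transition_density s t x z) * indicator F2 z \<partial>lborel)) \<partial>lborel)"
    using g unfolding pinned_mean_def
    by (subst nn_integral_cmult) (measurable, auto simp: mult.commute[of "ennreal ?g"] mult_divide_eq_ennreal)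
  finally show ?thesis .
qed

lemma transition_density_mass:
  assumes "s < t" "t < T"
  shows "(\<integral>\<^sup>+z. ennreal (transition_density s t x z) \<partial>lborel) = 1"
  using assms by (intro nn_integral_isotropic_normal pinned_var_pos lam) auto

text \<open>
  Any intermediate time does; with no restriction on the position there, the density integrates to one.
\<close>

lemma endpoints: "AE \<omega> in M. Z 0 \<omega> = 0" "AE \<omega> in M. Z T \<omega> = b m"
proof -
  have "emeasure M {\<omega> \<in> space M. Z 0 \<omega> \<in> {0} \<and> Z (T/2) \<omega> \<in> UNIV \<and> Z T \<omega> \<in> {b m}} = 1"
    using T transition_density_mass[of 0 "T/2" 0] by (subst one_time_law) auto
  then have "prob {\<omega> \<in> space M. Z 0 \<omega> = 0 \<and> Z T \<omega> = b m} = 1"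
    by (simp add: measure_def)
  then have "AE \<omega> in M. \<omega> \<in> {\<omega> \<in> space M. Z 0 \<omega> = 0 \<and> Z T \<omega> = b m}" by (rule AE_prob_1)
  then show "AE \<omega> in M. Z 0 \<omega> = 0" "AE \<omega> in M. Z T \<omega> = b m" by auto
qed

lemma marginal:
  assumes "0 < t" "t < T"
  shows "distributed M lborel (Z t) (transition_density 0 t 0)"
  unfolding distributed_def
proof (intro conjI)
  have [measurable]: "Z t \<in> borel_measurable M" using assms by (intro Z_measurable) auto
  show "Z t \<in> measurable M lborel" by simp
  show "(\<lambda>x. ennreal (transition_density 0 t 0 x)) \<in> borel_measurable lborel" by measurable
  show "distr M lborel (Z t) = density lborel (transition_density 0 t 0)"
  proof (rule measure_eqI)
    fix C assume "C \<in> sets (distr M lborel (Z t))"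
    then have [measurable]: "C \<in> sets borel" by simp
    have "emeasure (distr M lborel (Z t)) C = emeasure M (Z t -` C \<inter> space M)"
      by (subst emeasure_distr) auto
    also have "Z t -` C \<inter> space M = {\<omega> \<in> space M. Z 0 \<omega> \<in> UNIV \<and> Z t \<omega> \<in> C \<and> Z T \<omega> \<in> UNIV}" by auto
    finally show "emeasure (distr M lborel (Z t)) C = emeasure (density lborel (transition_density 0 t 0)) C"
      using assms one_time_law[of t UNIV C UNIV] by (simp add: emeasure_density)
  qed simp
qed

lemma markov: "markov_process T M Z"
  by (rule bernstein_imp_markov_if_terminal_const[OF bernstein endpoints(2)])

section \<open>Transition from the past\<close>

abbreviation past :: "real \<Rightarrow> 'w measure" where
  "past s \<equiv> generated_sigma M Z {0..s}"

lemma subalgebra_generated: "I \<subseteq> {0..T} \<Longrightarrow> subalgebra M (generated_sigma M Z I)"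
  by (intro subalgebra_generated_sigma Z_measurable) auto

definition transition_prob :: "real \<Rightarrow> real \<Rightarrow> (real ^ 'n) set \<Rightarrow> real ^ 'n \<Rightarrow> real" where
  "transition_prob s t C x = enn2real (\<integral>\<^sup>+z. ennreal (transition_density s t x z) * indicator C z \<partial>lborel)"

lemma borel_measurable_transition_prob [measurable]:
  assumes [measurable]: "C \<in> sets borel"
  shows "transition_prob s t C \<in> borel_measurable borel"
  unfolding transition_prob_def pinned_mean_def by measurable

lemma transition_prob:
  assumes "s < t" "t < T"
  shows ennreal_transition_prob:
      "ennreal (transition_prob s t C x) = (\<integral>\<^sup>+z. ennreal (transition_density s t x z) * indicator C z \<partial>lborel)"
    and transition_prob_nonneg: "0 \<le> transition_prob s t C x"
    and transition_prob_le_1: "transition_prob s t C x \<le> 1"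
proof -
  have le: "(\<integral>\<^sup>+z. ennreal (transition_density s t x z) * indicator C z \<partial>lborel) \<le> 1"
    unfolding transition_density_mass[OF assms, of x, symmetric]
    by (intro nn_integral_mono) (auto split: split_indicator)
  then have "(\<integral>\<^sup>+z. ennreal (transition_density s t x z) * indicator C z \<partial>lborel) < \<top>"
    by (rule le_less_trans) simp
  then show eq: "ennreal (transition_prob s t C x) = (\<integral>\<^sup>+z. ennreal (transition_density s t x z) * indicator C z \<partial>lborel)"
    unfolding transition_prob_def by simp
  show "0 \<le> transition_prob s t C x" by (simp add: transition_prob_def)
  show "transition_prob s t C x \<le> 1" using le unfolding eq[symmetric] by simp
qed

text \<open>
  At \<open>s = 0\<close> the process has no density, but its position is almost surely the origin, where the transition
  density is that of the marginal law.
\<close>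

lemma present_rectangle:
  assumes "0 \<le> s" "s < t" "t < T" and [measurable]: "B \<in> sets borel" "C \<in> sets borel"
  shows "emeasure M {\<omega> \<in> space M. Z s \<omega> \<in> B \<and> Z t \<omega> \<in> C}
    = (\<integral>\<^sup>+\<omega>. indicator B (Z s \<omega>) * ennreal (transition_prob s t C (Z s \<omega>)) \<partial>M)"
proof (cases "s = 0")
  case True
  have "emeasure M {\<omega> \<in> space M. Z s \<omega> \<in> B \<and> Z t \<omega> \<in> C} = ennreal (transition_prob 0 t C 0) * indicator B 0"
    using assms True one_time_law[of t B C UNIV] by (simp add: ennreal_transition_prob)
  also have "\<dots> = (\<integral>\<^sup>+\<omega>. indicator B 0 * ennreal (transition_prob s t C 0) \<partial>M)"
    using True by (simp add: emeasure_space_1 mult.commute)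
  also have "\<dots> = (\<integral>\<^sup>+\<omega>. indicator B (Z s \<omega>) * ennreal (transition_prob s t C (Z s \<omega>)) \<partial>M)"
    using endpoints(1) True by (intro nn_integral_cong_AE) auto
  finally show ?thesis .
next
  case False
  then have s: "0 < s" "s < T" using assms by auto
  have "emeasure M {\<omega> \<in> space M. Z s \<omega> \<in> B \<and> Z t \<omega> \<in> C}
    = (\<integral>\<^sup>+x. ennreal (transition_density 0 s 0 x) * (indicator B x * ennreal (transition_prob s t C x)) \<partial>lborel)"
    using assms s two_time_law[of s t UNIV B C UNIV] by (simp add: ennreal_transition_prob)
  also have "\<dots> = (\<integral>\<^sup>+\<omega>. indicator B (Z s \<omega>) * ennreal (transition_prob s t C (Z s \<omega>)) \<partial>M)"
    by (rule distributed_nn_integral[OF marginal[OF s]]) measurable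
  finally show ?thesis .
qed

text \<open>
  Densities speak of rectangle probabilities in extended nonnegative reals, conditional expectations of integrals of
  real functions; the lemma passes between the two.
\<close>

lemma rectangle_prob_iff_set_integral:
  assumes [measurable]: "a \<in> sets M" "Y \<in> borel_measurable M" "X \<in> borel_measurable M"
      "C \<in> sets borel" and st: "s < t" "t < T"
  shows "emeasure M (a \<inter> (Y -` C \<inter> space M)) = (\<integral>\<^sup>+\<omega>. indicator a \<omega> * ennreal (transition_prob s t C (X \<omega>)) \<partial>M)
    \<longleftrightarrow> (\<integral>\<omega>\<in>a. indicator C (Y \<omega>) \<partial>M) = (\<integral>\<omega>\<in>a. transition_prob s t C (X \<omega>) \<partial>M)"
proof -
  have i: "integrable M (\<lambda>\<omega>. indicator a \<omega> * transition_prob s t C (X \<omega>))"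
    using transition_prob_nonneg[OF st] transition_prob_le_1[OF st]
    by (intro integrable_const_bound[of _ 1]) (auto split: split_indicator)
  have "(\<integral>\<^sup>+\<omega>. indicator a \<omega> * ennreal (transition_prob s t C (X \<omega>)) \<partial>M)
      = (\<integral>\<^sup>+\<omega>. ennreal (indicator a \<omega> * transition_prob s t C (X \<omega>)) \<partial>M)"
    by (intro nn_integral_cong) (auto split: split_indicator)
  also have "\<dots> = ennreal (\<integral>\<omega>. indicator a \<omega> * transition_prob s t C (X \<omega>) \<partial>M)"
    using transition_prob_nonneg[OF st] by (intro nn_integral_eq_integral i) auto
  finally have 1: "(\<integral>\<^sup>+\<omega>. indicator a \<omega> * ennreal (transition_prob s t C (X \<omega>)) \<partial>M)
      = ennreal (\<integral>\<omega>\<in>a. transition_prob s t C (X \<omega>) \<partial>M)"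
    by (simp add: set_lebesgue_integral_def)
  have "(\<integral>\<omega>\<in>a. indicator C (Y \<omega>) \<partial>M) = (\<integral>\<omega>. indicat_real (a \<inter> (Y -` C \<inter> space M)) \<omega> \<partial>M)"
    unfolding set_lebesgue_integral_def
    by (intro Bochner_Integration.integral_cong) (auto split: split_indicator)
  then have 2: "emeasure M (a \<inter> (Y -` C \<inter> space M)) = ennreal (\<integral>\<omega>\<in>a. indicator C (Y \<omega>) \<partial>M)"
    by (simp add: emeasure_eq_measure)
  have "0 \<le> (\<integral>\<omega>\<in>a. transition_prob s t C (X \<omega>) \<partial>M)" "0 \<le> (\<integral>\<omega>\<in>a. indicator C (Y \<omega>) \<partial>M :: real)"
    unfolding set_lebesgue_integral_def using transition_prob_nonneg[OF st]
    by (auto intro!: Bochner_Integration.integral_nonneg)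
  then show ?thesis unfolding 1 2 by simp
qed

text \<open>
  The law of two times identifies the conditional probability of \<open>Z t \<in> C\<close> given \<open>Z s\<close>. The Markov property
  says that it is also the conditional probability given the whole past, so distributions of more
  than two intermediate times are determined by those of two.
\<close>

lemma past_rectangle:
  assumes st: "0 \<le> s" "s < t" "t < T" and a: "a \<in> sets (past s)" and [measurable]: "C \<in> sets borel"
  shows "emeasure M (a \<inter> (Z t -` C \<inter> space M))
    = (\<integral>\<^sup>+\<omega>. indicator a \<omega> * ennreal (transition_prob s t C (Z s \<omega>)) \<partial>M)"
proof -
  have [measurable]: "Z s \<in> borel_measurable M" "Z t \<in> borel_measurable M" using st by (auto intro!: Z_measurable)
  let ?S = "generated_sigma M Z {s}"
  let ?I = "\<lambda>\<omega>. indicator C (Z t \<omega>) :: real"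
  have sub: "subalgebra M (past s)" "subalgebra M ?S" using st by (auto intro!: subalgebra_generated)
  interpret P: finite_measure_subalgebra M "past s" by unfold_locales (rule sub)
  interpret S: finite_measure_subalgebra M ?S by unfold_locales (rule sub)
  have aM[measurable]: "a \<in> sets M" using a sub by (auto simp: subalgebra_def)
  have int: "integrable M ?I" by (intro integrable_const_bound[of _ 1]) auto
  \<comment> \<open>The two-time law, read as a conditional probability given the present.\<close>
  have present: "AE \<omega> in M. real_cond_exp M ?S ?I \<omega> = transition_prob s t C (Z s \<omega>)"
  proof (rule S.real_cond_exp_charact[OF _ int])
    show "integrable M (\<lambda>\<omega>. transition_prob s t C (Z s \<omega>))"
      using st transition_prob_nonneg[of s t] transition_prob_le_1[of s t]
      by (intro integrable_const_bound[of _ 1]) auto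
    show "(\<lambda>\<omega>. transition_prob s t C (Z s \<omega>)) \<in> borel_measurable ?S"
      by (rule measurable_compose[OF measurable_generated_sigma]) auto
    fix A assume "A \<in> sets ?S"
    then obtain B where A: "A = Z s -` B \<inter> space M" and [measurable]: "B \<in> sets borel"
      by (auto simp: sets_generated_sigma_single)
    have "A \<inter> (Z t -` C \<inter> space M) = {\<omega> \<in> space M. Z s \<omega> \<in> B \<and> Z t \<omega> \<in> C}" by (auto simp: A)
    then have "emeasure M (A \<inter> (Z t -` C \<inter> space M))
        = (\<integral>\<^sup>+\<omega>. indicator A \<omega> * ennreal (transition_prob s t C (Z s \<omega>)) \<partial>M)"
      using st by (simp add: present_rectangle)
        (auto intro!: nn_integral_cong simp: A split: split_indicator)
    then show "(\<integral>\<omega>\<in>A. ?I \<omega> \<partial>M) = (\<integral>\<omega>\<in>A. transition_prob s t C (Z s \<omega>) \<partial>M)"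
      using st by (subst rectangle_prob_iff_set_integral[symmetric]) (auto simp: A)
  qed
  \<comment> \<open>The Markov property replaces the present by the past.\<close>
  have "bounded (range (indicator C :: real ^ 'n \<Rightarrow> complex))"
    by (auto simp: bounded_iff indicator_def intro!: exI[of _ 1])
  then have "AE \<omega> in M. complex_cond_exp M (past s) (\<lambda>\<omega>. indicator C (Z t \<omega>)) \<omega>
      = complex_cond_exp M ?S (\<lambda>\<omega>. indicator C (Z t \<omega>)) \<omega>"
    using markov[unfolded markov_process_def, rule_format, of s t "indicator C"] st
    by auto
  then have "AE \<omega> in M. real_cond_exp M (past s) ?I \<omega> = real_cond_exp M ?S ?I \<omega>"
  proof eventually_elim
    case (elim \<omega>)
    have "(\<lambda>\<omega>. Re (indicator C (Z t \<omega>))) = ?I" by (auto split: split_indicator)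
    then show ?case using arg_cong[OF elim, of Re] by (simp add: complex_cond_exp_def)
  qed
  with present have ae: "AE \<omega> in M. real_cond_exp M (past s) ?I \<omega> = transition_prob s t C (Z s \<omega>)" by auto
  have "(\<integral>\<omega>\<in>a. ?I \<omega> \<partial>M) = (\<integral>\<omega>\<in>a. real_cond_exp M (past s) ?I \<omega> \<partial>M)"
    by (rule P.real_cond_exp_intA[OF int a])
  also have "\<dots> = (\<integral>\<omega>\<in>a. transition_prob s t C (Z s \<omega>) \<partial>M)"
    unfolding set_lebesgue_integral_def using ae by (intro integral_cong_AE) auto
  finally show ?thesis using st by (subst rectangle_prob_iff_set_integral) auto
qed

lemma transition_expectation:
  fixes H :: "'w \<Rightarrow> real ^ 'n \<Rightarrow> complex"
  assumes st: "0 \<le> s" "s < t" "t < T"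
    and H: "case_prod H \<in> borel_measurable (past s \<Otimes>\<^sub>M borel)" "\<And>\<omega> z. norm (H \<omega> z) \<le> K"
  shows "(\<integral>\<omega>. H \<omega> (Z t \<omega>) \<partial>M) = (\<integral>\<omega>. (\<integral>z. transition_density s t (Z s \<omega>) z *\<^sub>R H \<omega> z \<partial>lborel) \<partial>M)"
proof (rule expectation_of_transition_density[OF _ _ _ _ _ H])
  show "subalgebra M (past s)" using st by (auto intro!: subalgebra_generated)
  show "Z t \<in> borel_measurable M" using st by (auto intro!: Z_measurable)
  have [measurable]: "Z s \<in> borel_measurable (past s)" using st by (intro measurable_generated_sigma) auto
  show "(\<lambda>(\<omega>, z). transition_density s t (Z s \<omega>) z) \<in> borel_measurable (past s \<Otimes>\<^sub>M borel)"
    unfolding pinned_mean_def by measurable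
  show "emeasure M (a \<inter> (Z t -` C \<inter> space M))
    = (\<integral>\<^sup>+\<omega>. indicator a \<omega> * (\<integral>\<^sup>+z. ennreal (transition_density s t (Z s \<omega>) z) * indicator C z \<partial>lborel) \<partial>M)"
    if "a \<in> sets (past s)" "C \<in> sets borel" for a C
    using past_rectangle[OF st that] st by (simp add: ennreal_transition_prob)
qed simp

abbreviation centred :: "real \<Rightarrow> 'w \<Rightarrow> real ^ 'n" where
  "centred t \<omega> \<equiv> Z t \<omega> - bridge_mean lam T b m t"

lemma centred_endpoints: "AE \<omega> in M. centred 0 \<omega> = 0" "AE \<omega> in M. centred T \<omega> = 0"
  using endpoints lam T by (auto simp: bridge_mean_def)

text \<open>
  Conditionally on the past, \<open>centred t\<close> is Gaussian with mean proportional to \<open>centred s\<close> and with a deterministic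
  variance. At \<open>t = T\<close> both the factor and the variance degenerate to zero, in accordance with the terminal
  value being fixed.
\<close>

lemma transition_char:
  assumes st: "0 \<le> s" "s < t" "t \<le> T" and S: "S \<in> borel_measurable (past s)"
  shows "(CLINT \<omega>|M. iexp (S \<omega> + \<theta> \<bullet> centred t \<omega>))
    = (CLINT \<omega>|M. iexp (S \<omega> + (bridge_decay lam T s t *\<^sub>R \<theta>) \<bullet> centred s \<omega>))
      * complex_of_real (exp (- pinned_var lam (t - s) (T - t) * (\<theta> \<bullet> \<theta>) / 2))"
proof -
  have Hm: "(\<lambda>(\<omega>, z). iexp (S \<omega> + \<theta> \<bullet> (z - bridge_mean lam T b m t))) \<in> borel_measurable (past s \<Otimes>\<^sub>M borel)"
  proof -
    note [measurable] = S
    show ?thesis by measurable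
  qed
  have [measurable]: "Z s \<in> borel_measurable M" "Z t \<in> borel_measurable M" "Z T \<in> borel_measurable M"
    using st T by (auto intro!: Z_measurable)
  have [measurable]: "S \<in> borel_measurable M"
    using st by (intro measurable_from_subalg[OF subalgebra_generated S]) auto
  show ?thesis
  proof (cases "t = T")
    case True
    have "(CLINT \<omega>|M. iexp (S \<omega> + \<theta> \<bullet> centred t \<omega>)) = (CLINT \<omega>|M. iexp (S \<omega>))"
      using centred_endpoints(2) True by (intro integral_cong_AE) auto
    then show ?thesis using True by (simp add: bridge_decay_def pinned_var_def)
  next
    case False
    then have tT: "t < T" using st by simp
    have v: "pinned_var lam (t - s) (T - t) > 0" using lam st tT by (intro pinned_var_pos) auto
    let ?m = "bridge_mean lam T b m t" and ?p = "\<lambda>x. pinned_mean lam (t - s) (T - t) x (b m)"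
    let ?e = "complex_of_real (exp (- pinned_var lam (t - s) (T - t) * (\<theta> \<bullet> \<theta>) / 2))"
    have "(CLINT \<omega>|M. iexp (S \<omega> + \<theta> \<bullet> centred t \<omega>))
      = (CLINT \<omega>|M. (CLINT z|lborel. transition_density s t (Z s \<omega>) z *\<^sub>R iexp (S \<omega> + \<theta> \<bullet> (z - ?m))))"
      by (rule transition_expectation[OF st(1,2) tT Hm, where K=1]) simp
    also have "\<dots> = (CLINT \<omega>|M. iexp (S \<omega> + (bridge_decay lam T s t *\<^sub>R \<theta>) \<bullet> centred s \<omega>) * ?e)"
    proof (rule Bochner_Integration.integral_cong[OF refl])
      fix \<omega>
      have "(CLINT z|lborel. transition_density s t (Z s \<omega>) z *\<^sub>R iexp (S \<omega> + \<theta> \<bullet> (z - ?m)))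
        = (CLINT z|lborel. iexp (S \<omega> - \<theta> \<bullet> ?m) * (transition_density s t (Z s \<omega>) z *\<^sub>R iexp (\<theta> \<bullet> z)))"
        by (intro Bochner_Integration.integral_cong)
          (simp_all add: exp_add[symmetric] inner_diff_right algebra_simps)
      also have "\<dots> = iexp (S \<omega> - \<theta> \<bullet> ?m) * (iexp (\<theta> \<bullet> ?p (Z s \<omega>)) * ?e)"
        by (simp only: integral_mult_right_zero char_isotropic_normal[OF v])
      also have "\<dots> = iexp (S \<omega> + \<theta> \<bullet> (?p (Z s \<omega>) - ?m)) * ?e"
        by (simp add: exp_add[symmetric] inner_diff_right algebra_simps)
      also have "?p (Z s \<omega>) - ?m = bridge_decay lam T s t *\<^sub>R centred s \<omega>"
        using st tT lam T by (intro pinned_mean_minus_bridge_mean) auto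
      finally show "(CLINT z|lborel. transition_density s t (Z s \<omega>) z *\<^sub>R iexp (S \<omega> + \<theta> \<bullet> (z - ?m)))
        = iexp (S \<omega> + (bridge_decay lam T s t *\<^sub>R \<theta>) \<bullet> centred s \<omega>) * ?e" by simp
    qed
    finally show ?thesis by (simp only: integral_mult_left_zero)
  qed
qed


section \<open>Gaussianity and covariance\<close>

lemma centred_measurable: "t \<in> {0..T} \<Longrightarrow> centred t \<in> borel_measurable M"
  by (intro borel_measurable_diff Z_measurable) auto

text \<open>
  Induction on the latest time: \<open>transition_char\<close> absorbs its coefficient into the one of the latest earlier time.
  Including the time zero guarantees that there is an earlier time.
\<close>

lemma char_with_origin:
  assumes "finite J" "J \<subseteq> {0<..T}"
  shows "(CLINT \<omega>|M. iexp (\<Sum>t\<in>insert 0 J. a t \<bullet> centred t \<omega>))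
    = complex_of_real (exp (- cov_form (bridge_cov lam T) (insert 0 J) a a / 2))"
  using assms
proof (induction J arbitrary: a rule: finite_linorder_max_induct)
  case empty
  have [measurable]: "centred 0 \<in> borel_measurable M" using T by (intro centred_measurable) auto
  have "(CLINT \<omega>|M. iexp (a 0 \<bullet> centred 0 \<omega>)) = (CLINT \<omega>|M. 1)"
    using centred_endpoints(1) by (intro integral_cong_AE) auto
  then show ?case by (simp add: cov_form_def bridge_cov_def prob_space)
next
  case (insert t J)
  let ?C = "bridge_cov lam T"
  define s where "s = Max (insert 0 J)"
  have s: "s \<in> insert 0 J" "\<And>r. r \<in> insert 0 J \<Longrightarrow> r \<le> s"
    using insert.hyps Max_in[of "insert 0 J"] unfolding s_def by (simp_all only: finite_insert insert_not_empty Max_ge) simp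
  have t: "0 \<le> s" "s < t" "t \<le> T" using s insert.hyps insert.prems by auto
  then have sT: "s < T" by simp
  have tJ: "t \<notin> insert 0 J" using insert.hyps insert.prems by auto
  let ?a = "\<lambda>r. a r + (if r = s then bridge_decay lam T s t *\<^sub>R a t else 0)"
  let ?S = "\<lambda>\<omega>. \<Sum>r\<in>insert 0 J. a r \<bullet> centred r \<omega>"
  have S: "?S \<in> borel_measurable (past s)"
  proof (rule borel_measurable_sum)
    fix r assume "r \<in> insert 0 J"
    then have "r \<in> {0..s}" using s(2) insert.prems by auto
    from measurable_generated_sigma[OF this] show "(\<lambda>\<omega>. a r \<bullet> centred r \<omega>) \<in> borel_measurable (past s)"
      by (intro borel_measurable_inner borel_measurable_diff) auto
  qed
  have "(\<Sum>r\<in>insert 0 J. (if r = s then bridge_decay lam T s t *\<^sub>R a t else 0) \<bullet> centred r \<omega>)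
      = (bridge_decay lam T s t *\<^sub>R a t) \<bullet> centred s \<omega>" for \<omega>
  proof -
    have "(\<Sum>r\<in>insert 0 J. (if r = s then bridge_decay lam T s t *\<^sub>R a t else 0) \<bullet> centred r \<omega>)
      = (\<Sum>r\<in>insert 0 J. if r = s then (bridge_decay lam T s t *\<^sub>R a t) \<bullet> centred r \<omega> else 0)"
      by (rule sum.cong) auto
    then show ?thesis using insert.hyps s(1) by (simp only: sum.delta finite_insert if_True)
  qed
  then have shift: "?S \<omega> + (bridge_decay lam T s t *\<^sub>R a t) \<bullet> centred s \<omega> = (\<Sum>r\<in>insert 0 J. ?a r \<bullet> centred r \<omega>)" for \<omega>
    by (simp only: inner_add_left sum.distrib)
  have "(CLINT \<omega>|M. iexp (\<Sum>r\<in>insert 0 (insert t J). a r \<bullet> centred r \<omega>)) = (CLINT \<omega>|M. iexp (?S \<omega> + a t \<bullet> centred t \<omega>))"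
    using insert.hyps tJ by (subst insert_commute, subst sum.insert) (simp_all add: add.commute)
  also have "\<dots> = complex_of_real (exp (- cov_form ?C (insert 0 J) ?a ?a / 2))
      * complex_of_real (exp (- pinned_var lam (t - s) (T - t) * (a t \<bullet> a t) / 2))"
    using insert.IH[of ?a] insert.prems unfolding transition_char[OF t S] shift by simp
  also have "\<dots> = complex_of_real (exp (- (cov_form ?C (insert 0 J) ?a ?a
      + pinned_var lam (t - s) (T - t) * (a t \<bullet> a t)) / 2))"
    by (simp add: exp_add[symmetric] of_real_mult[symmetric] add_divide_distrib del: of_real_mult)
  also have "cov_form ?C (insert 0 J) ?a ?a + pinned_var lam (t - s) (T - t) * (a t \<bullet> a t)
      = cov_form ?C (insert t (insert 0 J)) a a"
  proof (rule cov_form_insert[symmetric])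
    show "finite (insert 0 J)" "s \<in> insert 0 J" "t \<notin> insert 0 J" using insert.hyps s(1) tJ by simp_all
    show "?C r q = ?C q r" for r q by (rule bridge_cov_commute)
    show "bridge_decay lam T s t * ?C r s = ?C r t" if "r \<in> insert 0 J" for r
      using s(2)[OF that] t(2) by (intro bridge_cov_past lam sT) simp_all
    show "?C t t = (bridge_decay lam T s t)\<^sup>2 * ?C s s + pinned_var lam (t - s) (T - t)"
      using t(2) by (intro bridge_cov_new lam T sT) simp
  qed
  finally show ?case by (simp only: insert_commute)
qed

lemma char_linear_combination:
  assumes J: "finite J" "J \<subseteq> {0..T}"
  shows "(CLINT \<omega>|M. iexp (\<Sum>t\<in>J. a t \<bullet> centred t \<omega>))
    = complex_of_real (exp (- cov_form (bridge_cov lam T) J a a / 2))"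
proof -
  have [measurable]: "t \<in> insert 0 J \<Longrightarrow> centred t \<in> borel_measurable M" for t
    using J T by (intro centred_measurable) auto
  have eq: "insert 0 J = insert 0 (J - {0})" by auto
  have "(CLINT \<omega>|M. iexp (\<Sum>t\<in>J. a t \<bullet> centred t \<omega>)) = (CLINT \<omega>|M. iexp (\<Sum>t\<in>insert 0 J. a t \<bullet> centred t \<omega>))"
  proof (rule integral_cong_AE)
    show "AE \<omega> in M. iexp (\<Sum>t\<in>J. a t \<bullet> centred t \<omega>) = iexp (\<Sum>t\<in>insert 0 J. a t \<bullet> centred t \<omega>)"
      using centred_endpoints(1) J(1) by (auto simp: sum.insert_if)
  qed measurable
  also have "\<dots> = complex_of_real (exp (- cov_form (bridge_cov lam T) (insert 0 J) a a / 2))"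
    unfolding eq using J by (intro char_with_origin) force+
  also have "cov_form (bridge_cov lam T) (insert 0 J) a a = cov_form (bridge_cov lam T) J a a"
  proof -
    \<comment> \<open>The value at time zero is deterministic, so adding it to the set of times changes no covariance.\<close>
    have z: "bridge_cov lam T 0 r = 0" "bridge_cov lam T r 0 = 0" if "r \<in> insert 0 J" for r
      using that J(2) by (auto simp: bridge_cov_def min_def)
    have "(\<Sum>q\<in>insert 0 J. bridge_cov lam T r q * (a r \<bullet> a q)) = (\<Sum>q\<in>J. bridge_cov lam T r q * (a r \<bullet> a q))"
      if "r \<in> insert 0 J" for r
      using z[OF that] J(1) by (simp add: sum.insert_if)
    then have "cov_form (bridge_cov lam T) (insert 0 J) a a
      = (\<Sum>r\<in>insert 0 J. \<Sum>q\<in>J. bridge_cov lam T r q * (a r \<bullet> a q))"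
      by (simp add: cov_form_def)
    also have "\<dots> = cov_form (bridge_cov lam T) J a a"
      using z J(1) by (simp add: cov_form_def sum.insert_if)
    finally show ?thesis .
  qed
  finally show ?thesis .
qed

lemma linear_combination_measurable:
  assumes "J \<subseteq> {0..T}"
  shows "(\<lambda>\<omega>. \<Sum>t\<in>J. a t \<bullet> Z t \<omega>) \<in> borel_measurable M"
    and "(\<lambda>\<omega>. \<Sum>t\<in>J. a t \<bullet> centred t \<omega>) \<in> borel_measurable M"
proof -
  have [measurable]: "t \<in> J \<Longrightarrow> Z t \<in> borel_measurable M" for t
    using assms by (intro Z_measurable) auto
  show "(\<lambda>\<omega>. \<Sum>t\<in>J. a t \<bullet> Z t \<omega>) \<in> borel_measurable M" by measurable
  show "(\<lambda>\<omega>. \<Sum>t\<in>J. a t \<bullet> centred t \<omega>) \<in> borel_measurable M" by measurable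
qed

lemma char_multiple:
  fixes u :: real
  assumes "finite J" "J \<subseteq> {0..T}"
  shows "(CLINT \<omega>|M. iexp (u * (\<Sum>t\<in>J. a t \<bullet> centred t \<omega>)))
    = complex_of_real (exp (- cov_form (bridge_cov lam T) J a a * u\<^sup>2 / 2))"
proof -
  have "(CLINT \<omega>|M. iexp (u * (\<Sum>t\<in>J. a t \<bullet> centred t \<omega>))) = (CLINT \<omega>|M. iexp (\<Sum>t\<in>J. (u *\<^sub>R a t) \<bullet> centred t \<omega>))"
    by (simp only: sum_distrib_left inner_scaleR_left)
  then show ?thesis unfolding char_linear_combination[OF assms] cov_form_scaleR by (simp add: mult.commute)
qed

lemma gaussian: "gaussian_process T M Z"
  unfolding gaussian_process_def
proof (intro allI impI)
  fix J and a :: "real \<Rightarrow> real ^ 'n"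
  assume J: "finite J \<and> J \<subseteq> {0..T}"
  let ?X = "\<lambda>\<omega>. \<Sum>t\<in>J. a t \<bullet> Z t \<omega>" and ?V = "cov_form (bridge_cov lam T) J a a"
  define c where "c = (\<Sum>t\<in>J. a t \<bullet> bridge_mean lam T b m t)"
  have Xm: "?X \<in> borel_measurable M" using J by (intro linear_combination_measurable) auto
  have char: "(CLINT \<omega>|M. iexp (u * ?X \<omega>)) = iexp (u * c) * complex_of_real (exp (- ?V * u\<^sup>2 / 2))" for u :: real
  proof -
    have "iexp (u * ?X \<omega>) = iexp (u * c) * iexp (u * (\<Sum>t\<in>J. a t \<bullet> centred t \<omega>))" for \<omega>
      unfolding c_def
      by (simp add: exp_add[symmetric] inner_diff_right sum_subtractf algebra_simps del: of_real_sum)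
    then show ?thesis using J by (simp only: integral_mult_right_zero char_multiple)
  qed
  note law = normal_law_of_char[OF Xm char]
  show "gaussian_variable M ?X"
  proof (cases "?V = 0")
    case True then show ?thesis using law(2) Xm by (auto simp: gaussian_variable_def)
  next
    case False
    then have "?V > 0" using law(1) by simp
    then show ?thesis using law(3) Xm unfolding gaussian_variable_def
      by (metis real_sqrt_gt_zero)
  qed
qed

text \<open>
  Polarisation: the second moments of \<open>v \<bullet> centred s \<plusminus> w \<bullet> centred t\<close> are known from the characteristic function. The
  coefficients are written as sums of two functions supported at \<open>s\<close> and at \<open>t\<close>, which also
  covers the case \<open>s = t\<close>.
\<close>

lemma covariance:
  assumes "s \<in> {0..T}" "t \<in> {0..T}"
  shows "has_bochner_integral M (\<lambda>\<omega>. (v \<bullet> centred s \<omega>) * (w \<bullet> centred t \<omega>)) (bridge_cov lam T s t * (v \<bullet> w))"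
proof -
  let ?C = "bridge_cov lam T" and ?J = "{s, t}"
  let ?p = "\<lambda>r. if r = s then v else 0" and ?q = "\<lambda>y r. if r = t then y else 0"
  have J: "finite ?J" "?J \<subseteq> {0..T}" using assms by auto
  have sq: "has_bochner_integral M (\<lambda>\<omega>. (v \<bullet> centred s \<omega> + y \<bullet> centred t \<omega>)\<^sup>2)
      (?C s s * (v \<bullet> v) + 2 * (?C s t * (v \<bullet> y)) + ?C t t * (y \<bullet> y))" for y
  proof -
    let ?a = "\<lambda>r. ?p r + ?q y r"
    have "has_bochner_integral M (\<lambda>\<omega>. (\<Sum>r\<in>?J. ?a r \<bullet> centred r \<omega>)\<^sup>2) (cov_form ?C ?J ?a ?a)"
      by (rule second_moment_of_char[OF linear_combination_measurable(2)[OF J(2)] char_multiple[OF J]])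
    moreover have "(\<Sum>r\<in>?J. ?a r \<bullet> centred r \<omega>) = v \<bullet> centred s \<omega> + y \<bullet> centred t \<omega>" for \<omega>
      by (cases "s = t") (auto simp: inner_add_left)
    moreover have "cov_form ?C ?J ?a ?a = ?C s s * (v \<bullet> v) + 2 * (?C s t * (v \<bullet> y)) + ?C t t * (y \<bullet> y)"
      unfolding cov_form_add_left cov_form_add_right
      by (simp add: cov_form_point_point inner_commute bridge_cov_commute[of lam T t s])
    ultimately show ?thesis by simp
  qed
  have "has_bochner_integral M
      (\<lambda>\<omega>. ((v \<bullet> centred s \<omega> + w \<bullet> centred t \<omega>)\<^sup>2 - (v \<bullet> centred s \<omega> + (- w) \<bullet> centred t \<omega>)\<^sup>2) / 4)
      (((?C s s * (v \<bullet> v) + 2 * (?C s t * (v \<bullet> w)) + ?C t t * (w \<bullet> w))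
        - (?C s s * (v \<bullet> v) + 2 * (?C s t * (v \<bullet> - w)) + ?C t t * (- w \<bullet> - w))) / 4)"
    by (intro has_bochner_integral_divide has_bochner_integral_diff sq)
  moreover have "((x + y)\<^sup>2 - (x + - y)\<^sup>2) / 4 = x * y" for x y :: real
    by (simp add: power2_eq_square algebra_simps)
  moreover have "(A + 2 * (c * x) + B - (A + 2 * (c * - x) + B)) / 4 = c * x" for A B c x :: real
    by simp
  ultimately show ?thesis by (simp only: inner_minus_left inner_minus_right minus_minus)
qed

lemma component_covariance:
  assumes "s \<in> {0..T}" "t \<in> {0..T}"
  shows "integrable M (\<lambda>\<omega>. (Z s \<omega> $ i - bridge_mean lam T b m s $ i) * (Z t \<omega> $ j - bridge_mean lam T b m t $ j))"
    and "(\<integral>\<omega>. (Z s \<omega> $ i - bridge_mean lam T b m s $ i) * (Z t \<omega> $ j - bridge_mean lam T b m t $ j) \<partial>M)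
      = bridge_cov lam T s t * of_bool (i = j)"
proof -
  have "axis i 1 \<bullet> (axis j 1 :: real ^ 'n) = of_bool (i = j)" by (simp add: inner_axis_axis)
  then have "has_bochner_integral M
      (\<lambda>\<omega>. (Z s \<omega> $ i - bridge_mean lam T b m s $ i) * (Z t \<omega> $ j - bridge_mean lam T b m t $ j))
      (bridge_cov lam T s t * of_bool (i = j))"
    using covariance[OF assms, of "axis i 1" "axis j 1"]
    by (simp only: inner_axis' vector_minus_component mult_1_left inner_real_def)
  then show "integrable M (\<lambda>\<omega>. (Z s \<omega> $ i - bridge_mean lam T b m s $ i) * (Z t \<omega> $ j - bridge_mean lam T b m t $ j))"
    and "(\<integral>\<omega>. (Z s \<omega> $ i - bridge_mean lam T b m s $ i) * (Z t \<omega> $ j - bridge_mean lam T b m t $ j) \<partial>M)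
      = bridge_cov lam T s t * of_bool (i = j)"
    by (auto simp: has_bochner_integral_iff)
qed

lemma transition_density_0:
  "transition_density 0 t 0 x = (2 * pi * bridge_var lam T t) powr (- real CARD('n) / 2)
    * exp (- (norm (x - bridge_mean lam T b m t))\<^sup>2 / (2 * bridge_var lam T t))"
  by (simp add: isotropic_normal_def bridge_mean_eq_pinned_mean bridge_var_eq_pinned_var)

lemma marginal_prob:
  assumes "0 < t" "t < T" and F: "F \<in> sets borel"
  shows "prob {\<omega> \<in> space M. Z t \<omega> \<in> F} = (2 * pi * bridge_var lam T t) powr (- real CARD('n) / 2) *
    (LINT x:F|lborel. exp (- (norm (x - bridge_mean lam T b m t))\<^sup>2 / (2 * bridge_var lam T t)))"
proof -
  note [measurable] = F
  have [measurable]: "Z t \<in> borel_measurable M" using assms by (intro Z_measurable) auto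
  have "prob {\<omega> \<in> space M. Z t \<omega> \<in> F} = (\<integral>\<omega>. indicat_real {\<omega> \<in> space M. Z t \<omega> \<in> F} \<omega> \<partial>M)"
    by simp
  also have "\<dots> = (\<integral>\<omega>. indicat_real F (Z t \<omega>) \<partial>M)"
    by (intro Bochner_Integration.integral_cong) (auto split: split_indicator)
  also have "\<dots> = (\<integral>x. transition_density 0 t 0 x * indicat_real F x \<partial>lborel)"
    by (rule distributed_integral[OF marginal[OF assms(1,2)], symmetric]) auto
  also have "\<dots> = (\<integral>x. (2 * pi * bridge_var lam T t) powr (- real CARD('n) / 2) *
      (indicator F x *\<^sub>R exp (- (norm (x - bridge_mean lam T b m t))\<^sup>2 / (2 * bridge_var lam T t))) \<partial>lborel)"
    unfolding transition_density_0 by (simp add: mult_ac)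
  finally show ?thesis by (simp only: integral_mult_right_zero set_lebesgue_integral_def)
qed

lemma marginal_expectation:
  fixes f :: "real ^ 'n \<Rightarrow> complex"
  assumes "0 < t" "t < T" and f: "f \<in> borel_measurable borel"
  shows "(\<integral>\<omega>. f (Z t \<omega>) \<partial>M) = complex_of_real ((2 * pi * bridge_var lam T t) powr (- real CARD('n) / 2)) *
    (\<integral>x. f x * complex_of_real (exp (- (norm (x - bridge_mean lam T b m t))\<^sup>2 / (2 * bridge_var lam T t))) \<partial>lborel)"
proof -
  have [measurable]: "Z t \<in> borel_measurable M" using assms by (intro Z_measurable) auto
  have "(\<integral>\<omega>. f (Z t \<omega>) \<partial>M) = (\<integral>x. f x \<partial>distr M lborel (Z t))"
    using f by (subst integral_distr) auto
  also have "\<dots> = (\<integral>x. transition_density 0 t 0 x *\<^sub>R f x \<partial>lborel)"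
    using f by (subst distributed_distr_eq_density[OF marginal[OF assms(1,2)]], subst integral_density) auto
  also have "\<dots> = (\<integral>x. complex_of_real ((2 * pi * bridge_var lam T t) powr (- real CARD('n) / 2)) *
      (f x * complex_of_real (exp (- (norm (x - bridge_mean lam T b m t))\<^sup>2 / (2 * bridge_var lam T t)))) \<partial>lborel)"
    unfolding transition_density_0 by (simp add: scaleR_conv_of_real mult_ac)
  finally show ?thesis by (simp only: integral_mult_right_zero)
qed

text \<open>
  A shift by \<open>T/2\<close> would carry the law of \<open>Z 0\<close>, a point mass at the origin, to the law of \<open>Z (T/2)\<close>, which has a
  density. This holds also when \<open>b m = 0\<close>.
\<close>

lemma nonstationary: "\<not> stationary_process T M Z"
proof
  assume st: "stationary_process T M Z"
  let ?P = "\<Pi>\<^sub>M t\<in>{0::real}. (borel :: (real ^ 'n) measure)"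
  have [measurable]: "Z 0 \<in> borel_measurable M" "Z (T/2) \<in> borel_measurable M"
    using T by (auto intro!: Z_measurable)
  have ev[measurable]: "(\<lambda>f. f 0) \<in> measurable ?P borel" by (rule measurable_component_singleton) simp
  have "distr M ?P (\<lambda>\<omega>. \<lambda>t\<in>{0}. Z (t + T/2) \<omega>) = distr M ?P (\<lambda>\<omega>. \<lambda>t\<in>{0}. Z t \<omega>)"
    using st[unfolded stationary_process_def, rule_format, of "{0}" "T/2"] T by simp
  then have "distr (distr M ?P (\<lambda>\<omega>. \<lambda>t\<in>{0}. Z (t + T/2) \<omega>)) borel (\<lambda>f. f 0)
      = distr (distr M ?P (\<lambda>\<omega>. \<lambda>t\<in>{0}. Z t \<omega>)) borel (\<lambda>f. f 0)" by simp
  moreover have "(\<lambda>\<omega>. \<lambda>t\<in>{0}. Z (t + T/2) \<omega>) \<in> measurable M ?P" "(\<lambda>\<omega>. \<lambda>t\<in>{0}. Z t \<omega>) \<in> measurable M ?P"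
    by (rule measurable_restrict; simp)+
  ultimately have D: "distr M borel (Z (T/2)) = distr M borel (Z 0)"
    by (simp add: distr_distr comp_def)
  \<comment> \<open>Points are null sets for Lebesgue measure, hence for the law at an interior time.\<close>
  have "AE x in lborel. x \<noteq> (0 :: real ^ 'n)" by (rule AE_lborel_singleton)
  then have "AE x in distr M lborel (Z (T/2)). x \<noteq> 0"
    using T by (subst distributed_distr_eq_density[OF marginal]) (auto simp: AE_density)
  then have "AE \<omega> in M. Z (T/2) \<omega> \<noteq> 0" by (subst (asm) AE_distr_iff) auto
  then have "AE x in distr M borel (Z (T/2)). x \<noteq> 0" by (subst AE_distr_iff) auto
  then have "AE \<omega> in M. Z 0 \<omega> \<noteq> 0" unfolding D by (subst (asm) AE_distr_iff) auto
  from this endpoints(1) have "AE \<omega> in M. False" by eventually_elim simp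
  then show False by simp
qed

end

theorem corollary3:
  fixes lam T :: real
    and b :: "nat ^ 'n \<Rightarrow> real ^ 'n"
    and m :: "nat ^ 'n"
  assumes "lam > 0" and "T > 0"
  shows "prob_space (endpoint_measure lam T b m) \<and>
    (\<forall>(M :: 'w measure) Z. associated_bernstein_process lam T (endpoint_measure lam T b m) M Z \<longrightarrow>
      \<not> stationary_process T M Z \<and> gaussian_process T M Z \<and> markov_process T M Z \<and>
      (\<forall>t F. 0 < t \<and> t < T \<and> F \<in> sets borel \<longrightarrow>
         measure M {\<omega> \<in> space M. Z t \<omega> \<in> F} =
         (2 * pi * bridge_var lam T t) powr (- real CARD('n) / 2) *
         (LINT x:F|lborel. exp (- (norm (x - bridge_mean lam T b m t))\<^sup>2 / (2 * bridge_var lam T t)))) \<and>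
      measure M {\<omega> \<in> space M. Z 0 \<omega> = 0} = 1 \<and>
      measure M {\<omega> \<in> space M. Z T \<omega> = b m} = 1 \<and>
      (\<forall>s t i j. 0 \<le> s \<and> s \<le> T \<and> 0 \<le> t \<and> t \<le> T \<longrightarrow>
         integrable M (\<lambda>\<omega>. (Z s \<omega> $ i - bridge_mean lam T b m s $ i) * (Z t \<omega> $ j - bridge_mean lam T b m t $ j)) \<and>
         (t \<ge> s \<longrightarrow>
           (\<integral>\<omega>. (Z s \<omega> $ i - bridge_mean lam T b m s $ i) * (Z t \<omega> $ j - bridge_mean lam T b m t $ j) \<partial>M) =
           sinh (lam * (T - t)) * sinh (lam * s) / (lam * sinh (lam * T)) * of_bool (i = j)) \<and>
         (t \<le> s \<longrightarrow>
           (\<integral>\<omega>. (Z s \<omega> $ i - bridge_mean lam T b m s $ i) * (Z t \<omega> $ j - bridge_mean lam T b m t $ j) \<partial>M) =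
           sinh (lam * (T - s)) * sinh (lam * t) / (lam * sinh (lam * T)) * of_bool (i = j))) \<and>
      (\<forall>(f :: real ^ 'n \<Rightarrow> complex) t. f \<in> borel_measurable borel \<and> bounded (range f) \<and> 0 < t \<and> t < T \<longrightarrow>
         (\<integral>\<omega>. f (Z t \<omega>) \<partial>M) =
         complex_of_real ((2 * pi * bridge_var lam T t) powr (- real CARD('n) / 2)) *
         (\<integral>x. f x * complex_of_real (exp (- (norm (x - bridge_mean lam T b m t))\<^sup>2 / (2 * bridge_var lam T t))) \<partial>lborel)))"
proof (intro conjI allI impI, goal_cases)
  case 1
  show ?case unfolding endpoint_measure_eq_return[OF assms]
    by (rule prob_space_return) (simp add: space_pair_measure)
next
  case (2 M Z)
  then interpret dirac_bernstein lam T b m M Z using assms by unfold_locales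
  show ?case by (rule nonstationary)
next
  case (3 M Z)
  then interpret dirac_bernstein lam T b m M Z using assms by unfold_locales
  show ?case by (rule gaussian)
next
  case (4 M Z)
  then interpret dirac_bernstein lam T b m M Z using assms by unfold_locales
  show ?case by (rule markov)
next
  case (5 M Z t F)
  then interpret dirac_bernstein lam T b m M Z using assms by unfold_locales
  show ?case using 5 by (intro marginal_prob) auto
next
  case (6 M Z)
  then interpret dirac_bernstein lam T b m M Z using assms by unfold_locales
  show ?case using endpoints(1) Z_measurable[of 0] assms by (intro prob_Collect_eq_1[THEN iffD2]) auto
next
  case (7 M Z)
  then interpret dirac_bernstein lam T b m M Z using assms by unfold_locales
  show ?case using endpoints(2) Z_measurable[of T] assms by (intro prob_Collect_eq_1[THEN iffD2]) auto
next
  case (8 M Z s t i j)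
  then interpret dirac_bernstein lam T b m M Z using assms by unfold_locales
  show ?case using 8 by (intro component_covariance) auto
next
  case (9 M Z s t i j)
  then interpret dirac_bernstein lam T b m M Z using assms by unfold_locales
  show ?case using 9 component_covariance(2)[of s t i j] by (simp add: bridge_cov_def max_absorb2 min_absorb1)
next
  case (10 M Z s t i j)
  then interpret dirac_bernstein lam T b m M Z using assms by unfold_locales
  show ?case using 10 component_covariance(2)[of s t i j] by (simp add: bridge_cov_def max_absorb1 min_absorb2)
next
  case (11 M Z f t)
  then interpret dirac_bernstein lam T b m M Z using assms by unfold_locales
  show ?case using 11 by (intro marginal_expectation) auto
qed

end
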